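(* Let $0<m<k\le n$ be integers and set $\nu=k/n$, $\mu=m/n$. Let $s(\theta)$ be a real random variable (the individual loss at parameter $\theta$) and let $s_1(\theta),\dots,s_n(\theta)$ be independent samples of it. If $\mathrm{supp}(s(\theta))\subseteq[a,b]$ and $s(\theta)$ has a continuous distribution function, then for any $\delta\in(0,1]$, $$\Pr\left(\mathcal{L}-\widehat{\mathcal{L}} \leq(b-a)\left[\sqrt{\frac{5k\ln(3/\delta)}{n^2}}+\sqrt{\frac{\ln(1/\delta)}{2n}}\right]\right)\geq 1-\delta,$$ $$\Pr\left(\mathcal{L}-\widehat{\mathcal{L}} \geq -(b-a)\left[\sqrt{\frac{5m\ln(3/\delta)}{n^2}}+\sqrt{\frac{\ln(1/\delta)}{2n}}\right]\right)\geq 1-\delta,$$ where $\mathcal{L}=\nu C_\nu[s(\theta)]-\mu C_\mu[s(\theta)]$ and $\widehat{\mathcal{L}}=\nu\widehat{C}_\nu[s(\theta)]-\mu\widehat{C}_\mu[s(\theta)]$.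
   Context: Let $[a]_+=\max\{0,a\}$. The conditional value at risk at level $\alpha$ of a real random variable $s$ is $C_\alpha[s]=\inf_{\lambda\in\mathbb{R}}\{\lambda+\frac1\alpha\mathbb{E}[[s-\lambda]_+]\}$, and its empirical version based on independent samples $s_1,\dots,s_n$ of $s$ is $\widehat{C}_\alpha[s]=\inf_{\lambda\in\mathbb{R}}\{\lambda+\frac{1}{n\alpha}\sum_{i=1}^n[s_i-\lambda]_+\}$ (the same formulas are used for $\alpha=1$). *)

theory Defs
  imports "HOL-Probability.Probability"
begin

definition pos_part :: "real \<Rightarrow> real" where
  "pos_part x = max 0 x"

(* Topological support of the law of X: the smallest closed set of full measure. *)
definition law_support :: "'w measure \<Rightarrow> ('w \<Rightarrow> real) \<Rightarrow> real set" where
  "law_support M X = {x. \<forall>U. open U \<and> x \<in> U \<longrightarrow> measure (distr M borel X) U > 0}"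

(* The Inf on type real is meaningful for integrable X and 0 < \<alpha> \<le> 1: the objective is then
   bounded below by the expectation of X. *)
definition cvar :: "'w measure \<Rightarrow> real \<Rightarrow> ('w \<Rightarrow> real) \<Rightarrow> real" where
  "cvar M \<alpha> X =
     (INF l::real. l + 1 / \<alpha> * (\<integral>\<omega>. pos_part (X \<omega> - l) \<partial>M))"

(* Samples are indexed by {1..n}; other values of x are irrelevant. *)
definition empirical_cvar :: "nat \<Rightarrow> real \<Rightarrow> (nat \<Rightarrow> real) \<Rightarrow> real" where
  "empirical_cvar n \<alpha> x =
     (INF l::real. l + 1 / (real n * \<alpha>) * (\<Sum>i=1..n. pos_part (x i - l)))"

end

theory Submission
  imports Defs
begin

text \<open>
  Write \<open>L = \<nu> C\<^sub>\<nu> - \<mu> C\<^sub>\<mu>\<close>. Applying separate deviation bounds to \<open>C\<^sub>\<nu>\<close> and \<open>C\<^sub>\<mu>\<close> and a union bound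
  would only give confidence \<open>1 - 2\<delta>\<close>. Instead, the empirical \<open>L\<close> is treated as one function of the
  sample: by submodularity of \<open>(x, l) \<mapsto> pos_part (x - l)\<close> it changes by at most \<open>(b - a) / n\<close> when
  one observation changes, so McDiarmid's inequality bounds its deviation from its mean by the
  \<open>ln (1 / \<delta>)\<close> term. The other term only has to absorb the bias. The mean of an
  infimum is at most the infimum of the means, so the empirical version of \<open>\<alpha> C\<^sub>\<alpha>\<close> has mean at most
  \<open>\<alpha> C\<^sub>\<alpha>\<close>. Conversely, a subgradient at the true quantile \<open>q\<close> shows that the mean falls short by at
  most \<open>(b - a) E\<bar>N / n - \<alpha>\<bar> \<le> (b - a) sqrt (\<alpha> / n)\<close>, where \<open>N\<close> is the number of observations above \<open>q\<close>.
\<close>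

section \<open>McDiarmid's inequality\<close>

text \<open>Induction on \<open>J\<close>: averaging over coordinate \<open>i\<close> turns
  \<open>f\<close> into a function \<open>g\<close> of the other coordinates with the same mean, sup
  bound and difference bounds. With those coordinates fixed, \<open>f\<close> ranges over an
  interval of length \<open>c i\<close>, so Hoeffding's lemma contributes the factor
  \<open>exp (l\<^sup>2 * (c i)\<^sup>2 / 8)\<close>. Nonnegative integrals let Fubini split the
  exponential directly.\<close>

lemma (in product_prob_space) McDiarmid_mgf:
  fixes f :: "('i \<Rightarrow> 'a) \<Rightarrow> real" and c :: "'i \<Rightarrow> real"
  assumes "finite J" and "l > 0"
    and "f \<in> borel_measurable (Pi\<^sub>M J M)"
    and "\<And>x. x \<in> space (Pi\<^sub>M J M) \<Longrightarrow> \<bar>f x\<bar> \<le> B"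
    and "\<And>x i y. x \<in> space (Pi\<^sub>M J M) \<Longrightarrow> i \<in> J \<Longrightarrow> y \<in> space (M i) \<Longrightarrow>
           \<bar>f (x(i := y)) - f x\<bar> \<le> c i"
  shows "(\<integral>\<^sup>+x. exp (l * (f x - (\<integral>x. f x \<partial>Pi\<^sub>M J M))) \<partial>Pi\<^sub>M J M)
           \<le> ennreal (exp (l\<^sup>2 * (\<Sum>i\<in>J. (c i)\<^sup>2) / 8))"
  using assms(1,3-)
proof (induction J arbitrary: f rule: finite_induct)
  case empty
  interpret E: prob_space "Pi\<^sub>M {} M"
    by (rule prob_space_PiM) (rule prob_space)
  \<comment> \<open>Without coordinates the product space is the single point
    \<open>\<lambda>_. undefined\<close>, so \<open>f\<close> is constant on it.\<close>
  define e where "e = f (\<lambda>_. undefined)"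
  have f: "f x = e" if "x \<in> space (Pi\<^sub>M {} M)" for x
    using that by (simp add: space_PiM e_def)
  have "(\<integral>x. f x \<partial>Pi\<^sub>M {} M) = (\<integral>x. e \<partial>Pi\<^sub>M {} M)"
    by (rule Bochner_Integration.integral_cong) (auto simp: f)
  then have int: "(\<integral>x. f x \<partial>Pi\<^sub>M {} M) = e"
    by (simp add: E.prob_space)
  have "(\<integral>\<^sup>+x. exp (l * (f x - e)) \<partial>Pi\<^sub>M {} M) = (\<integral>\<^sup>+x. 1 \<partial>Pi\<^sub>M {} M)"
    by (intro nn_integral_cong) (simp add: f)
  also have "\<dots> = 1"
    by (simp add: E.emeasure_space_1)
  finally show ?case
    by (simp add: int)
next
  case (insert i J)
  note f[measurable] = insert.prems(1) and bound = insert.prems(2) and diff = insert.prems(3)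
  interpret J: prob_space "Pi\<^sub>M J M"
    by (rule prob_space_PiM) (rule prob_space)
  interpret iI: prob_space "Pi\<^sub>M (insert i J) M"
    by (rule prob_space_PiM) (rule prob_space)
  have upd: "x(i := y) \<in> space (Pi\<^sub>M (insert i J) M)"
    if "x \<in> space (Pi\<^sub>M J M)" "y \<in> space (M i)" for x y
    using that by (auto simp: space_PiM PiE_def extensional_def)
  have f_upd[measurable]: "(\<lambda>y. f (x(i := y))) \<in> borel_measurable (M i)"
    if [measurable]: "x \<in> space (Pi\<^sub>M J M)" for x
  proof -
    have "(\<lambda>y. x(i := y)) \<in> M i \<rightarrow>\<^sub>M Pi\<^sub>M (insert i J) M"
      using that by (intro measurable_fun_upd[where J = J and I = "insert i J"]) auto
    then show ?thesis by measurable
  qed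
  have f_upd_int: "integrable (M i) (\<lambda>y. f (x(i := y)))" if "x \<in> space (Pi\<^sub>M J M)" for x
    using that by (intro M.integrable_const_bound[of _ B] AE_I2) (auto intro!: bound upd)
  \<comment> \<open>The conditional expectation of \<open>f\<close> given the coordinates in
    \<open>J\<close>.\<close>
  define g where "g x = (\<integral>y. f (x(i := y)) \<partial>M i)" for x
  have f_pair: "(\<lambda>(x, y). f (x(i := y))) \<in> borel_measurable (Pi\<^sub>M J M \<Otimes>\<^sub>M M i)"
    using measurable_compose[OF measurable_add_dim f] by (simp add: case_prod_unfold)
  have g[measurable]: "g \<in> borel_measurable (Pi\<^sub>M J M)"
    unfolding g_def by (rule M.borel_measurable_lebesgue_integral) (fact f_pair)
  have g_bound: "\<bar>g x\<bar> \<le> B" if x: "x \<in> space (Pi\<^sub>M J M)" for x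
  proof -
    have "\<bar>g x\<bar> \<le> (\<integral>y. \<bar>f (x(i := y))\<bar> \<partial>M i)"
      unfolding g_def by (rule integral_abs_bound)
    also have "\<dots> \<le> (\<integral>y. B \<partial>M i)"
      using x by (intro integral_mono integrable_abs f_upd_int) (auto intro!: bound upd)
    finally show ?thesis by (simp add: M.prob_space)
  qed
  have g_diff: "\<bar>g (x(j := z)) - g x\<bar> \<le> c j"
    if x: "x \<in> space (Pi\<^sub>M J M)" and j: "j \<in> J" and z: "z \<in> space (M j)" for x j z
  proof -
    have "j \<noteq> i"
      using j insert.hyps(2) by auto
    have xz: "x(j := z) \<in> space (Pi\<^sub>M J M)"
      using x z j by (auto simp: space_PiM PiE_def extensional_def)
    have "g (x(j := z)) - g x = (\<integral>y. f (x(j := z, i := y)) - f (x(i := y)) \<partial>M i)"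
      unfolding g_def using f_upd_int[OF x] f_upd_int[OF xz] by simp
    also have "\<bar>\<dots>\<bar> \<le> (\<integral>y. \<bar>f (x(j := z, i := y)) - f (x(i := y))\<bar> \<partial>M i)"
      by (rule integral_abs_bound)
    also have "\<dots> \<le> (\<integral>y. c j \<partial>M i)"
    proof (intro integral_mono integrable_abs Bochner_Integration.integrable_diff f_upd_int x xz)
      fix y assume "y \<in> space (M i)"
      then have "\<bar>f ((x(i := y))(j := z)) - f (x(i := y))\<bar> \<le> c j"
        using j z by (intro diff upd x) auto
      then show "\<bar>f (x(j := z, i := y)) - f (x(i := y))\<bar> \<le> c j"
        by (simp only: fun_upd_twist[OF \<open>j \<noteq> i\<close>])
    qed auto
    finally show ?thesis by (simp add: M.prob_space)
  qed
  have "integrable (Pi\<^sub>M (insert i J) M) f"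
    by (rule iI.integrable_const_bound[of _ B]) (auto intro!: bound)
  then have int_f: "(\<integral>x. f x \<partial>Pi\<^sub>M (insert i J) M) = (\<integral>x. g x \<partial>Pi\<^sub>M J M)"
    unfolding g_def by (intro product_integral_insert insert.hyps)
  define m where "m = (\<integral>x. g x \<partial>Pi\<^sub>M J M)"
  have inner: "(\<integral>\<^sup>+y. exp (l * (f (x(i := y)) - m)) \<partial>M i)
      \<le> ennreal (exp (l * (g x - m))) * ennreal (exp (l\<^sup>2 * (c i)\<^sup>2 / 8))"
    if x: "x \<in> space (Pi\<^sub>M J M)" for x
  proof -
    \<comment> \<open>Two values of \<open>f (x(i := y))\<close> differ by an update of coordinate
      \<open>i\<close> alone, hence by at most \<open>c i\<close>; so all of them lie within
      \<open>c i\<close> above their infimum, which \<open>B\<close> keeps finite.\<close>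
    define A where "A = (INF y\<in>space (M i). f (x(i := y)))"
    have bdd: "bdd_below ((\<lambda>y. f (x(i := y))) ` space (M i))"
    proof (rule bdd_belowI2[of _ "- B"])
      fix z assume "z \<in> space (M i)"
      then show "- B \<le> f (x(i := z))"
        using abs_le_D2[OF bound[OF upd[OF x]]] by fastforce
    qed
    have "f (x(i := y)) \<in> {A..A + c i}" if y: "y \<in> space (M i)" for y
    proof -
      have "f (x(i := y)) - c i \<le> A"
        unfolding A_def
      proof (rule cINF_greatest)
        fix z assume z: "z \<in> space (M i)"
        show "f (x(i := y)) - c i \<le> f (x(i := z))"
        proof -
          have "\<bar>f ((x(i := z))(i := y)) - f (x(i := z))\<bar> \<le> c i"
            using y z by (intro diff upd x) auto
          then show ?thesis
            by (simp only: fun_upd_upd)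
        qed
      qed (rule M.not_empty)
      moreover have "A \<le> f (x(i := y))"
        unfolding A_def by (rule cINF_lower[OF bdd y])
      ultimately show ?thesis by auto
    qed
    then interpret interval_bounded_random_variable "M i" "\<lambda>y. f (x(i := y))" A "A + c i"
      using x by unfold_locales auto
    \<comment> \<open>Centring at the mean \<open>g x\<close> of the section instead of
      \<open>m\<close> leaves a factor constant in \<open>y\<close> and a moment generating function
      to which Hoeffding's lemma applies.\<close>
    have "(\<integral>\<^sup>+y. exp (l * (f (x(i := y)) - m)) \<partial>M i)
        = (\<integral>\<^sup>+y. ennreal (exp (l * (g x - m))) * ennreal (exp (l * (f (x(i := y)) - g x))) \<partial>M i)"
      by (intro nn_integral_cong) (simp flip: ennreal_mult' exp_add add: algebra_simps)
    also have "\<dots> = ennreal (exp (l * (g x - m))) * (\<integral>\<^sup>+y. exp (l * (f (x(i := y)) - g x)) \<partial>M i)"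
      using x by (intro nn_integral_cmult) simp
    also have "\<dots> \<le> ennreal (exp (l * (g x - m))) * ennreal (exp (l\<^sup>2 * (c i)\<^sup>2 / 8))"
      using Hoeffdings_lemma_nn_integral[OF \<open>l > 0\<close>] by (intro mult_left_mono) (auto simp: g_def)
    finally show ?thesis .
  qed
  have "(\<integral>\<^sup>+x. exp (l * (f x - m)) \<partial>Pi\<^sub>M (insert i J) M)
      = (\<integral>\<^sup>+x. \<integral>\<^sup>+y. exp (l * (f (x(i := y)) - m)) \<partial>M i \<partial>Pi\<^sub>M J M)"
    by (intro product_nn_integral_insert insert.hyps) simp
  also have "\<dots> \<le> (\<integral>\<^sup>+x. ennreal (exp (l * (g x - m))) * ennreal (exp (l\<^sup>2 * (c i)\<^sup>2 / 8)) \<partial>Pi\<^sub>M J M)"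
    by (intro nn_integral_mono inner)
  also have "\<dots> = (\<integral>\<^sup>+x. ennreal (exp (l * (g x - m))) \<partial>Pi\<^sub>M J M) * ennreal (exp (l\<^sup>2 * (c i)\<^sup>2 / 8))"
    by (intro nn_integral_multc) simp
  also have "\<dots> \<le> ennreal (exp (l\<^sup>2 * (\<Sum>j\<in>J. (c j)\<^sup>2) / 8)) * ennreal (exp (l\<^sup>2 * (c i)\<^sup>2 / 8))"
    unfolding m_def by (intro mult_right_mono insert.IH g g_bound g_diff) auto
  also have "\<dots> = ennreal (exp (l\<^sup>2 * (\<Sum>j\<in>insert i J. (c j)\<^sup>2) / 8))"
    using insert.hyps by (simp flip: ennreal_mult' exp_add add: field_simps)
  finally show ?case
    by (simp add: int_f m_def)
qed

text \<open>The joint law of independent variables is the product of their laws, so the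
  product-space bound applies to it; the Chernoff bound then yields the tail.\<close>

lemma (in prob_space) McDiarmid_ineq_ge:
  fixes f :: "('i \<Rightarrow> 'b) \<Rightarrow> real" and c :: "'i \<Rightarrow> real" and X :: "'i \<Rightarrow> 'a \<Rightarrow> 'b"
  assumes I: "finite I" and indep: "indep_vars N X I"
    and f[measurable]: "f \<in> borel_measurable (Pi\<^sub>M I N)"
    and bound: "\<And>x. x \<in> space (Pi\<^sub>M I N) \<Longrightarrow> \<bar>f x\<bar> \<le> B"
    and diff: "\<And>x i y. x \<in> space (Pi\<^sub>M I N) \<Longrightarrow> i \<in> I \<Longrightarrow> y \<in> space (N i) \<Longrightarrow>
           \<bar>f (x(i := y)) - f x\<bar> \<le> c i"
    and pos: "(\<Sum>i\<in>I. (c i)\<^sup>2) > 0" and \<epsilon>: "\<epsilon> > 0"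
  defines "Z \<equiv> \<lambda>\<omega>. f (\<lambda>i\<in>I. X i \<omega>)"
  shows "prob {\<omega>\<in>space M. Z \<omega> \<ge> expectation Z + \<epsilon>} \<le> exp (- 2 * \<epsilon>\<^sup>2 / (\<Sum>i\<in>I. (c i)\<^sup>2))"
proof -
  \<comment> \<open>The locale asks for a probability measure at every index, so indices outside
    \<open>I\<close> receive a dummy point mass.\<close>
  define D where "D i = (if i \<in> I then distr M (N i) (X i) else return (count_space UNIV) undefined)" for i
  have X[measurable]: "i \<in> I \<Longrightarrow> X i \<in> M \<rightarrow>\<^sub>M N i" for i
    using indep by (simp add: indep_vars_def)
  have "prob_space (D i)" for i
    by (auto simp: D_def intro!: prob_space_distr prob_space_return)
  then interpret D: product_prob_space D I
    by (simp add: product_prob_space_def product_prob_space_axioms_def product_sigma_finite_def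
        prob_space_imp_sigma_finite)
  have "I \<noteq> {}" using pos by auto
  define XX where "XX \<omega> = (\<lambda>i\<in>I. X i \<omega>)" for \<omega>
  have XX[measurable]: "XX \<in> M \<rightarrow>\<^sub>M Pi\<^sub>M I N"
    unfolding XX_def by measurable
  have "Pi\<^sub>M I D = (\<Pi>\<^sub>M i\<in>I. distr M (N i) (X i))"
    by (rule PiM_cong) (auto simp: D_def)
  then have PiD: "distr M (Pi\<^sub>M I N) XX = Pi\<^sub>M I D"
    using indep_vars_iff_distr_eq_PiM'[OF \<open>I \<noteq> {}\<close>, where M' = N and X = X] indep
    by (simp add: XX_def[abs_def])
  have sets: "sets (Pi\<^sub>M I D) = sets (Pi\<^sub>M I N)"
    unfolding PiD[symmetric] by simp
  have Z: "Z \<omega> = f (XX \<omega>)" for \<omega>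
    by (simp add: Z_def XX_def)
  have EZ: "expectation Z = (\<integral>x. f x \<partial>Pi\<^sub>M I D)"
    unfolding PiD[symmetric] Z by (rule integral_distr[symmetric]) measurable
  have mgf: "(\<integral>\<^sup>+\<omega>. exp (l * (Z \<omega> - expectation Z)) \<partial>M)
      \<le> ennreal (exp (l\<^sup>2 * (\<Sum>i\<in>I. (c i)\<^sup>2) / 8))" if "l > 0" for l
  proof -
    have "(\<integral>\<^sup>+\<omega>. exp (l * (Z \<omega> - expectation Z)) \<partial>M)
        = (\<integral>\<^sup>+x. exp (l * (f x - expectation Z)) \<partial>Pi\<^sub>M I D)"
      unfolding PiD[symmetric] Z by (rule nn_integral_distr[symmetric]) measurable
    also have "\<dots> \<le> ennreal (exp (l\<^sup>2 * (\<Sum>i\<in>I. (c i)\<^sup>2) / 8))"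
      unfolding EZ
    proof (rule D.McDiarmid_mgf[OF I that, where B = B])
      show "f \<in> borel_measurable (Pi\<^sub>M I D)"
        using f measurable_cong_sets[OF sets refl] by blast
    qed (use bound diff sets_eq_imp_space_eq[OF sets] in \<open>auto simp: D_def\<close>)
    finally show ?thesis .
  qed
  define d where "d = (\<Sum>i\<in>I. (c i)\<^sup>2)"
  \<comment> \<open>The minimiser of the exponent
    \<open>- l * \<epsilon> + l\<^sup>2 * d / 8\<close>; the minimum is
    \<open>- 2 * \<epsilon>\<^sup>2 / d\<close>.\<close>
  define l where "l = 4 * \<epsilon> / d"
  have d: "d > 0" using pos by (simp add: d_def)
  have l: "l > 0" using \<epsilon> d by (simp add: l_def)
  have [measurable]: "Z \<in> borel_measurable M"
    unfolding Z by measurable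
  have "{\<omega>\<in>space M. Z \<omega> \<ge> expectation Z + \<epsilon>} = {\<omega>\<in>space M. Z \<omega> - expectation Z \<ge> \<epsilon>}"
    by auto
  then have "ennreal (prob {\<omega>\<in>space M. Z \<omega> \<ge> expectation Z + \<epsilon>})
      = emeasure M {\<omega>\<in>space M. Z \<omega> - expectation Z \<ge> \<epsilon>}"
    by (simp add: emeasure_eq_measure)
  also have "\<dots> \<le> ennreal (exp (- l * \<epsilon>)) *
      (\<integral>\<^sup>+\<omega>\<in>space M. exp (l * (Z \<omega> - expectation Z)) \<partial>M)"
    by (intro Chernoff_ineq_nn_integral_ge l) auto
  also have "(\<integral>\<^sup>+\<omega>\<in>space M. exp (l * (Z \<omega> - expectation Z)) \<partial>M)
      = (\<integral>\<^sup>+\<omega>. exp (l * (Z \<omega> - expectation Z)) \<partial>M)"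
    by (intro nn_integral_cong) auto
  also have "ennreal (exp (- l * \<epsilon>)) * \<dots> \<le> ennreal (exp (- l * \<epsilon>)) * ennreal (exp (l\<^sup>2 * d / 8))"
    unfolding d_def by (intro mult_left_mono mgf l) auto
  also have "\<dots> = ennreal (exp (- 2 * \<epsilon>\<^sup>2 / d))"
    using d by (simp flip: ennreal_mult' exp_add add: l_def power2_eq_square field_simps)
  finally show ?thesis
    by (simp add: d_def)
qed

section \<open>Conditional value at risk\<close>

lemma pos_part_measurable[measurable]: "pos_part \<in> borel_measurable borel"
  unfolding pos_part_def[abs_def] by measurable

lemma pos_part_mono: "x \<le> y \<Longrightarrow> pos_part x \<le> pos_part y"
  by (simp add: pos_part_def)

lemma (in prob_space) integrable_pos_part:
  assumes "integrable M X"
  shows "integrable M (\<lambda>\<omega>. pos_part (X \<omega> - l))"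
  unfolding pos_part_def using assms by auto

lemma (in prob_space) integrable_of_range:
  fixes X :: "'a \<Rightarrow> real"
  assumes "X \<in> borel_measurable M" and "\<And>\<omega>. \<omega> \<in> space M \<Longrightarrow> X \<omega> \<in> {a..b}"
  shows "integrable M X"
  by (rule integrable_const_bound[of _ "\<bar>a\<bar> + \<bar>b\<bar>"]) (use assms in \<open>force intro!: AE_I2\<close>)+

text \<open>With \<open>cvar_lower\<close>, this characterises
  \<open>\<alpha> * cvar M \<alpha> X\<close> as an infimum over \<open>l\<close>. Scaling by
  \<alpha> removes the factor \<open>1 / \<alpha>\<close> from the integral and gives the form in
  which the levels \<nu> and \<mu> are later subtracted.\<close>

lemma (in prob_space) cvar_greatest:
  assumes "0 < \<alpha>" and "\<And>l. c \<le> \<alpha> * l + (\<integral>\<omega>. pos_part (X \<omega> - l) \<partial>M)"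
  shows "c \<le> \<alpha> * cvar M \<alpha> X"
proof -
  have "c / \<alpha> \<le> cvar M \<alpha> X"
    unfolding cvar_def
    by (rule cINF_greatest) (use assms in \<open>auto simp: field_simps\<close>)
  with assms(1) show ?thesis by (simp add: field_simps)
qed

text \<open>A real \<open>INF\<close> is a lower bound only for a family bounded below. Here
  \<open>expectation X\<close> bounds the objective, because the mean of \<open>X - l\<close> is at
  most that of its positive part and \<open>1 / \<alpha>\<close> is at least 1.\<close>

lemma (in prob_space) cvar_lower:
  assumes "0 < \<alpha>" "\<alpha> \<le> 1" and X: "integrable M X"
  shows "\<alpha> * cvar M \<alpha> X \<le> \<alpha> * l + (\<integral>\<omega>. pos_part (X \<omega> - l) \<partial>M)"
proof -
  have "expectation X \<le> l + 1 / \<alpha> * (\<integral>\<omega>. pos_part (X \<omega> - l) \<partial>M)" for l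
  proof -
    have "expectation X - l = (\<integral>\<omega>. X \<omega> - l \<partial>M)"
      using X by (simp add: prob_space)
    also have "\<dots> \<le> (\<integral>\<omega>. pos_part (X \<omega> - l) \<partial>M)"
      using X by (intro integral_mono integrable_pos_part) (auto simp: pos_part_def)
    also have "\<dots> \<le> 1 / \<alpha> * (\<integral>\<omega>. pos_part (X \<omega> - l) \<partial>M)"
    proof -
      have "0 \<le> (\<integral>\<omega>. pos_part (X \<omega> - l) \<partial>M)"
        by (intro Bochner_Integration.integral_nonneg) (simp add: pos_part_def)
      then show ?thesis
        using mult_right_mono[of 1 "1 / \<alpha>"] assms by simp
    qed
    finally show ?thesis by simp
  qed
  then have "bdd_below (range (\<lambda>l. l + 1 / \<alpha> * (\<integral>\<omega>. pos_part (X \<omega> - l) \<partial>M)))"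
    by (intro bdd_belowI2)
  from cINF_lower[OF this, of l] have "cvar M \<alpha> X \<le> l + 1 / \<alpha> * (\<integral>\<omega>. pos_part (X \<omega> - l) \<partial>M)"
    by (simp add: cvar_def)
  with assms(1) show ?thesis by (simp add: field_simps)
qed

lemma cvar_cong_AE:
  assumes "AE \<omega> in M. X \<omega> = Y \<omega>" and [measurable]: "X \<in> borel_measurable M" "Y \<in> borel_measurable M"
  shows "cvar M \<alpha> X = cvar M \<alpha> Y"
proof -
  have "(\<integral>\<omega>. pos_part (X \<omega> - l) \<partial>M) = (\<integral>\<omega>. pos_part (Y \<omega> - l) \<partial>M)" for l
    using assms(1) by (intro integral_cong_AE) auto
  then show ?thesis by (simp add: cvar_def)
qed

section \<open>Comparison of CVaR across variables, levels and choices of \<open>l\<close>\<close>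

context prob_space
begin

lemma cvar_mono:
  assumes "0 < \<alpha>" "\<alpha> \<le> 1" and X: "integrable M X" and Y: "integrable M Y"
    and le: "\<And>\<omega>. \<omega> \<in> space M \<Longrightarrow> X \<omega> \<le> Y \<omega>"
  shows "\<alpha> * cvar M \<alpha> X \<le> \<alpha> * cvar M \<alpha> Y"
proof (rule cvar_greatest[OF \<open>0 < \<alpha>\<close>])
  fix l
  have "(\<integral>\<omega>. pos_part (X \<omega> - l) \<partial>M) \<le> (\<integral>\<omega>. pos_part (Y \<omega> - l) \<partial>M)"
    using le by (intro integral_mono integrable_pos_part X Y) (auto intro!: pos_part_mono)
  with cvar_lower[OF assms(1,2) X, of l]
  show "\<alpha> * cvar M \<alpha> X \<le> \<alpha> * l + (\<integral>\<omega>. pos_part (Y \<omega> - l) \<partial>M)" by linarith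
qed

text \<open>Since \<open>pos_part\<close> is 1-Lipschitz, at each \<open>l\<close> the objective of
  \<open>Y\<close> exceeds that of \<open>X\<close> by at most the mean of \<open>Y - X\<close>, and
  this passes to the infima.\<close>

lemma cvar_diff_le:
  assumes "0 < \<alpha>" "\<alpha> \<le> 1" and X: "integrable M X" and Y: "integrable M Y"
    and le: "\<And>\<omega>. \<omega> \<in> space M \<Longrightarrow> X \<omega> \<le> Y \<omega>"
  shows "\<alpha> * cvar M \<alpha> Y - \<alpha> * cvar M \<alpha> X \<le> expectation (\<lambda>\<omega>. Y \<omega> - X \<omega>)"
proof -
  have "\<alpha> * cvar M \<alpha> Y - expectation (\<lambda>\<omega>. Y \<omega> - X \<omega>) \<le> \<alpha> * cvar M \<alpha> X"
  proof (rule cvar_greatest[OF \<open>0 < \<alpha>\<close>])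
    fix l
    have "(\<integral>\<omega>. pos_part (Y \<omega> - l) \<partial>M) \<le> (\<integral>\<omega>. pos_part (X \<omega> - l) + (Y \<omega> - X \<omega>) \<partial>M)"
      using le by (intro integral_mono integrable_pos_part X Y Bochner_Integration.integrable_add
          Bochner_Integration.integrable_diff) (auto simp: pos_part_def max_def)
    also have "\<dots> = (\<integral>\<omega>. pos_part (X \<omega> - l) \<partial>M) + expectation (\<lambda>\<omega>. Y \<omega> - X \<omega>)"
      using X Y by (intro Bochner_Integration.integral_add integrable_pos_part) auto
    finally show "\<alpha> * cvar M \<alpha> Y - expectation (\<lambda>\<omega>. Y \<omega> - X \<omega>)
        \<le> \<alpha> * l + (\<integral>\<omega>. pos_part (X \<omega> - l) \<partial>M)"
      using cvar_lower[OF assms(1,2) Y, of l] by linarith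
  qed
  then show ?thesis by linarith
qed

text \<open>\<open>(x, l) \<mapsto> pos_part (x - l)\<close> is submodular, being a convex function of \<open>x - l\<close>; since the
  term \<open>\<alpha> * l\<close> favours smaller \<open>l\<close> for larger \<open>\<alpha>\<close>, minimising over \<open>l\<close> makes this
  supermodularity in \<open>(X, \<alpha>)\<close>.\<close>

lemma cvar_supermodular:
  assumes "0 < \<beta>" "\<beta> \<le> \<alpha>" "\<alpha> \<le> 1" and X: "integrable M X" and Y: "integrable M Y"
    and le: "\<And>\<omega>. \<omega> \<in> space M \<Longrightarrow> X \<omega> \<le> Y \<omega>"
  shows "\<alpha> * cvar M \<alpha> X + \<beta> * cvar M \<beta> Y \<le> \<alpha> * cvar M \<alpha> Y + \<beta> * cvar M \<beta> X"
proof -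
  have \<alpha>: "0 < \<alpha>" and \<beta>: "\<beta> \<le> 1" using assms by auto
  define G where "G Z l = (\<integral>\<omega>. pos_part (Z \<omega> - l) \<partial>M)" for Z :: "'a \<Rightarrow> real" and l
  have sub: "G X l + G Y l' \<le> G Y l + G X l'" if "l \<le> l'" for l l'
  proof -
    have "G X l + G Y l' = (\<integral>\<omega>. pos_part (X \<omega> - l) + pos_part (Y \<omega> - l') \<partial>M)"
      unfolding G_def by (intro Bochner_Integration.integral_add[symmetric] integrable_pos_part X Y)
    also have "\<dots> \<le> (\<integral>\<omega>. pos_part (Y \<omega> - l) + pos_part (X \<omega> - l') \<partial>M)"
    proof (intro integral_mono Bochner_Integration.integrable_add integrable_pos_part X Y)
      fix \<omega> assume "\<omega> \<in> space M"
      from le[OF this] that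
      show "pos_part (X \<omega> - l) + pos_part (Y \<omega> - l') \<le> pos_part (Y \<omega> - l) + pos_part (X \<omega> - l')"
        by (auto simp: pos_part_def max_def)
    qed
    also have "\<dots> = G Y l + G X l'"
      unfolding G_def by (intro Bochner_Integration.integral_add integrable_pos_part X Y)
    finally show ?thesis .
  qed
  have lower: "\<alpha> * cvar M \<alpha> X \<le> \<alpha> * l + G X l" "\<beta> * cvar M \<beta> Y \<le> \<beta> * l + G Y l" for l
    unfolding G_def using cvar_lower \<alpha> \<beta> assms by auto
  have *: "\<alpha> * cvar M \<alpha> X + \<beta> * cvar M \<beta> Y \<le> (\<alpha> * l + G Y l) + (\<beta> * l' + G X l')" for l l'
  proof (cases "l \<le> l'")
    case True
    then show ?thesis
      using sub[OF True] lower(1)[of l] lower(2)[of l'] by linarith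
  next
    \<comment> \<open>For \<open>l' < l\<close>, exchanging the two points keeps the
      \<open>G\<close> terms and cannot increase the linear ones, as \<beta> \<le> \<alpha>.\<close>
    case False
    then have "0 \<le> (\<alpha> - \<beta>) * (l - l')" using assms by simp
    then have "\<alpha> * l' + \<beta> * l \<le> \<alpha> * l + \<beta> * l'" by (simp add: algebra_simps)
    then show ?thesis using lower(1)[of l'] lower(2)[of l] by linarith
  qed
  have "\<alpha> * cvar M \<alpha> X + \<beta> * cvar M \<beta> Y - (\<alpha> * l + G Y l) \<le> \<beta> * cvar M \<beta> X" for l
  proof (intro cvar_greatest[OF \<open>0 < \<beta>\<close>], fold G_def)
    show "\<alpha> * cvar M \<alpha> X + \<beta> * cvar M \<beta> Y - (\<alpha> * l + G Y l) \<le> \<beta> * l' + G X l'" for l'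
      using *[of l l'] by linarith
  qed
  then have "\<alpha> * cvar M \<alpha> X + \<beta> * cvar M \<beta> Y - \<beta> * cvar M \<beta> X \<le> \<alpha> * cvar M \<alpha> Y"
    by (intro cvar_greatest[OF \<open>0 < \<alpha>\<close>]) (simp add: G_def[symmetric] algebra_simps)
  then show ?thesis by linarith
qed

text \<open>The objective is convex in \<open>l\<close>, and \<alpha> minus the probability of
  exceeding \<open>q\<close> is a subgradient at \<open>q\<close>. The supporting line falls by at
  most \<open>b - a\<close> times the size of that slope on the interval, and only \<open>l\<close>
  in the interval matter. The result is meant for an empirical measure, where \<open>q\<close> need
  not be an exact quantile.\<close>

lemma cvar_ge_at_level:
  assumes "0 < \<alpha>" "\<alpha> \<le> 1" and X[measurable]: "X \<in> borel_measurable M"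
    and ab: "\<And>\<omega>. \<omega> \<in> space M \<Longrightarrow> X \<omega> \<in> {a..b}" and q: "q \<in> {a..b}"
  shows "\<alpha> * q + (\<integral>\<omega>. pos_part (X \<omega> - q) \<partial>M)
           - (b - a) * \<bar>prob {\<omega>\<in>space M. q < X \<omega>} - \<alpha>\<bar> \<le> \<alpha> * cvar M \<alpha> X"
proof (rule cvar_greatest[OF \<open>0 < \<alpha>\<close>])
  fix l
  define N where "N = {\<omega>\<in>space M. q < X \<omega>}"
  define G where "G l = (\<integral>\<omega>. pos_part (X \<omega> - l) \<partial>M)" for l
  have [measurable]: "N \<in> events" unfolding N_def by measurable
  have X_int: "integrable M X"
    by (rule integrable_of_range[OF X ab])
  \<comment> \<open>Projecting \<open>l\<close> to the interval does not raise the objective: left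
    of \<open>a\<close> its slope is \<alpha> - 1, at most 0, and right of \<open>b\<close> it is
    \<alpha>.\<close>
  define l' where "l' = max a (min b l)"
  have l': "l' \<in> {a..b}" using q by (auto simp: l'_def)
  have shift: "\<alpha> * l' + G l' \<le> \<alpha> * l + G l"
  proof -
    have "\<alpha> * (l' - l) + pos_part (X \<omega> - l') \<le> pos_part (X \<omega> - l)" if "\<omega> \<in> space M" for \<omega>
    proof -
      consider "l < a" | "l \<in> {a..b}" | "b < l" by fastforce
      then show ?thesis
      proof cases
        case 1
        then have "l' = a" and le: "\<alpha> * (a - l) \<le> a - l"
          using assms q mult_right_mono[of \<alpha> 1 "a - l"] by (auto simp: l'_def)
        then show ?thesis
          using 1 ab[OF that] by (simp add: pos_part_def) (use le in linarith)
      next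
        case 2
        then have "l' = l" by (auto simp: l'_def)
        then show ?thesis by simp
      next
        case 3
        then have "l' = b" and "\<alpha> * (b - l) \<le> 0"
          using assms q by (auto simp: l'_def intro!: mult_nonneg_nonpos)
        then show ?thesis using 3 ab[OF that] by (simp add: pos_part_def)
      qed
    qed
    then have "(\<integral>\<omega>. \<alpha> * (l' - l) + pos_part (X \<omega> - l') \<partial>M) \<le> G l"
      unfolding G_def using X_int
      by (intro integral_mono Bochner_Integration.integrable_add integrable_pos_part) auto
    also have "(\<integral>\<omega>. \<alpha> * (l' - l) + pos_part (X \<omega> - l') \<partial>M) = \<alpha> * (l' - l) + G l'"
      unfolding G_def using integrable_pos_part[OF X_int, of l'] by (simp add: prob_space)
    finally show ?thesis by (simp add: algebra_simps)
  qed
  \<comment> \<open>The pointwise subgradient inequality for the positive part, integrated: at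
    \<open>q\<close> its derivative in \<open>l\<close> is -1 on \<open>N\<close> and is taken as 0
    off \<open>N\<close>.\<close>
  have "(\<integral>\<omega>. pos_part (X \<omega> - q) + (q - l') * indicator N \<omega> \<partial>M) \<le> G l'"
    unfolding G_def using X_int
  proof (intro integral_mono Bochner_Integration.integrable_add integrable_pos_part)
    show "integrable M (\<lambda>\<omega>. (q - l') * indicator N \<omega>)"
      by (simp add: emeasure_eq_measure)
  qed (auto simp: N_def pos_part_def indicator_def max_def)
  also have "(\<integral>\<omega>. pos_part (X \<omega> - q) + (q - l') * indicator N \<omega> \<partial>M) = G q + (q - l') * prob N"
    unfolding G_def using integrable_pos_part[OF X_int, of q] by (simp add: emeasure_eq_measure)
  finally have "\<alpha> * q + G q + (q - l') * (prob N - \<alpha>) \<le> \<alpha> * l' + G l'"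
    by (simp add: algebra_simps)
  moreover have "\<bar>(q - l') * (prob N - \<alpha>)\<bar> \<le> (b - a) * \<bar>prob N - \<alpha>\<bar>"
    unfolding abs_mult using q l' by (intro mult_right_mono) auto
  ultimately show "\<alpha> * q + (\<integral>\<omega>. pos_part (X \<omega> - q) \<partial>M)
      - (b - a) * \<bar>prob {\<omega>\<in>space M. q < X \<omega>} - \<alpha>\<bar> \<le> \<alpha> * l + (\<integral>\<omega>. pos_part (X \<omega> - l) \<partial>M)"
    using shift unfolding N_def G_def by linarith
qed

end

section \<open>Empirical CVaR as the CVaR under the uniform measure on the sample indices\<close>

lemma empirical_cvar_eq_cvar:
  "empirical_cvar n \<alpha> x = cvar (uniform_count_measure {1..n}) \<alpha> x"
  by (simp add: empirical_cvar_def cvar_def integral_uniform_count_measure mult.commute)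

lemma integrable_uniform_count_measure:
  fixes f :: "'a \<Rightarrow> real"
  assumes "finite A"
  shows "integrable (uniform_count_measure A) f"
  unfolding uniform_count_measure_def by (rule integrable_point_measure_finite) fact

lemma prob_space_uniform_1_n:
  assumes "0 < n"
  shows "prob_space (uniform_count_measure {1..n::nat})"
  using assms by (intro prob_space_uniform_count_measure) auto

text \<open>The infimum over all reals is replaced by one over the rationals, which is measurable as
  a countable infimum. A rational \<open>r\<close> slightly above \<open>l\<close> suffices: the
  positive parts shrink, and the linear term grows by at most \<open>r - l\<close> because \<alpha>
  \<le> 1.\<close>

lemma empirical_cvar_measurable:
  assumes n: "0 < n" and \<alpha>: "0 < \<alpha>" "\<alpha> \<le> 1"
    and [measurable]: "\<And>i. i \<in> {1..n} \<Longrightarrow> (\<lambda>\<omega>. X \<omega> i) \<in> borel_measurable M"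
  shows "(\<lambda>\<omega>. \<alpha> * empirical_cvar n \<alpha> (X \<omega>)) \<in> borel_measurable M"
proof -
  define G where "G x l = \<alpha> * l + (\<Sum>i=1..n. pos_part (x i - l)) / n" for x :: "nat \<Rightarrow> real" and l
  interpret U: prob_space "uniform_count_measure {1..n}"
    by (rule prob_space_uniform_1_n) fact
  have "\<alpha> * empirical_cvar n \<alpha> x = (INF r\<in>\<rat>. G x r)" for x
  proof (rule antisym)
    have lower: "\<alpha> * empirical_cvar n \<alpha> x \<le> G x l" for l
      using U.cvar_lower[OF \<alpha> integrable_uniform_count_measure, of x l]
      by (simp add: empirical_cvar_eq_cvar G_def integral_uniform_count_measure)
    then show "\<alpha> * empirical_cvar n \<alpha> x \<le> (INF r\<in>\<rat>. G x r)"
      by (intro cINF_greatest) auto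
    have bdd: "bdd_below (G x ` \<rat>)"
      using lower by (intro bdd_belowI2)
    have "(INF r\<in>\<rat>. G x r) \<le> G x l" for l
    proof (rule field_le_epsilon)
      fix e :: real assume "0 < e"
      then obtain r where r: "r \<in> \<rat>" "l < r" "r < l + e"
        using Rats_dense_in_real[of l "l + e"] by auto
      have "(INF r\<in>\<rat>. G x r) \<le> G x r"
        by (rule cINF_lower[OF bdd r(1)])
      also have "\<dots> \<le> \<alpha> * l + e + (\<Sum>i=1..n. pos_part (x i - l)) / n"
      proof -
        have "\<alpha> * (r - l) \<le> 1 * (r - l)"
          using \<alpha> r by (intro mult_right_mono) auto
        then have "\<alpha> * r \<le> \<alpha> * l + e"
          using r by (simp add: algebra_simps)
        moreover have "(\<Sum>i=1..n. pos_part (x i - r)) / n \<le> (\<Sum>i=1..n. pos_part (x i - l)) / n"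
          using r by (intro divide_right_mono sum_mono) (auto simp: pos_part_def)
        ultimately show ?thesis by (simp add: G_def)
      qed
      finally show "(INF r\<in>\<rat>. G x r) \<le> G x l + e" by (simp add: G_def)
    qed
    then show "(INF r\<in>\<rat>. G x r) \<le> \<alpha> * empirical_cvar n \<alpha> x"
      unfolding empirical_cvar_eq_cvar
      by (intro U.cvar_greatest \<alpha>) (simp add: G_def integral_uniform_count_measure)
  qed
  moreover have "(\<lambda>\<omega>. INF r\<in>\<rat>. G (X \<omega>) r) \<in> borel_measurable M"
    unfolding G_def by (intro borel_measurable_cINF_real countable_rat) measurable
  ultimately show ?thesis by simp
qed

section \<open>Bias of the empirical conditional value at risk\<close>

text \<open>Independence and zero means kill the cross terms of the squared sum, so second moments
  add; the first absolute moment is at most the root of the second.\<close>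

lemma (in prob_space) expectation_abs_sum_le:
  fixes Z :: "'i \<Rightarrow> 'a \<Rightarrow> real"
  assumes I: "finite I" and indep: "indep_vars (\<lambda>_. borel) Z I"
    and sq: "\<And>i. i \<in> I \<Longrightarrow> integrable M (\<lambda>\<omega>. (Z i \<omega>)\<^sup>2)"
    and mean: "\<And>i. i \<in> I \<Longrightarrow> expectation (Z i) = 0"
    and var: "\<And>i. i \<in> I \<Longrightarrow> expectation (\<lambda>\<omega>. (Z i \<omega>)\<^sup>2) \<le> v"
  shows "expectation (\<lambda>\<omega>. \<bar>\<Sum>i\<in>I. Z i \<omega>\<bar>) \<le> sqrt (real (card I) * v)"
proof -
  have Z[measurable]: "i \<in> I \<Longrightarrow> Z i \<in> borel_measurable M" for i
    using indep by (simp add: indep_vars_def)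
  have Z_int: "integrable M (Z i)" if "i \<in> I" for i
    using that by (intro square_integrable_imp_integrable[OF Z sq])
  have pair: "integrable M (\<lambda>\<omega>. Z i \<omega> * Z j \<omega>)
      \<and> expectation (\<lambda>\<omega>. Z i \<omega> * Z j \<omega>) = (if i = j then expectation (\<lambda>\<omega>. (Z i \<omega>)\<^sup>2) else 0)"
    if ij: "i \<in> I" "j \<in> I" for i j
  proof (cases "i = j")
    case True
    then show ?thesis using sq[OF ij(1)] by (simp add: power2_eq_square)
  next
    case False
    have indep_ij: "indep_vars (\<lambda>_. borel) Z {i, j}"
      using ij by (intro indep_vars_subset[OF indep]) auto
    show ?thesis
      using indep_vars_integrable[OF _ indep_ij] indep_vars_lebesgue_integral[OF _ indep_ij]
        ij False mean Z_int by auto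
  qed
  have sum_int: "integrable M (\<lambda>\<omega>. \<Sum>i\<in>I. Z i \<omega>)"
    using Z_int by auto
  have sum_sq: "(\<Sum>i\<in>I. Z i \<omega>)\<^sup>2 = (\<Sum>i\<in>I. \<Sum>j\<in>I. Z i \<omega> * Z j \<omega>)" for \<omega>
    by (simp add: power2_eq_square sum_product)
  have sum_sq_int: "integrable M (\<lambda>\<omega>. (\<Sum>i\<in>I. Z i \<omega>)\<^sup>2)"
    unfolding sum_sq using pair by (intro Bochner_Integration.integrable_sum) auto
  have "expectation (\<lambda>\<omega>. (\<Sum>i\<in>I. Z i \<omega>)\<^sup>2) = (\<Sum>i\<in>I. \<Sum>j\<in>I. expectation (\<lambda>\<omega>. Z i \<omega> * Z j \<omega>))"
    unfolding sum_sq using pair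
    by (simp add: Bochner_Integration.integral_sum)
  also have "\<dots> = (\<Sum>i\<in>I. expectation (\<lambda>\<omega>. (Z i \<omega>)\<^sup>2))"
    using pair I by (simp add: sum.delta)
  also have "\<dots> \<le> real (card I) * v"
    using var by (intro sum_bounded_above) auto
  finally have "expectation (\<lambda>\<omega>. (\<Sum>i\<in>I. Z i \<omega>)\<^sup>2) \<le> real (card I) * v" .
  \<comment> \<open>This is nonnegativity of the variance of the absolute value of the sum.\<close>
  moreover have "(expectation (\<lambda>\<omega>. \<bar>\<Sum>i\<in>I. Z i \<omega>\<bar>))\<^sup>2 \<le> expectation (\<lambda>\<omega>. (\<Sum>i\<in>I. Z i \<omega>)\<^sup>2)"
    using variance_positive[of "\<lambda>\<omega>. \<bar>\<Sum>i\<in>I. Z i \<omega>\<bar>"] sum_int sum_sq_int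
    by (subst (asm) variance_eq) auto
  ultimately show ?thesis
    by (intro real_le_rsqrt) linarith
qed

text \<open>The objective at \<open>l = b\<close> bounds the scaled value above by
  \<open>\<alpha> * b\<close>, and \<open>\<alpha> * (a - l) \<le> pos_part (a - l)\<close> bounds
  it below by \<open>\<alpha> * a\<close>. The crude form serves integrability and the sup bound in
  McDiarmid's inequality.\<close>

lemma (in prob_space) cvar_bounds:
  assumes "0 < \<alpha>" "\<alpha> \<le> 1" and X[measurable]: "X \<in> borel_measurable M"
    and ab: "\<And>\<omega>. \<omega> \<in> space M \<Longrightarrow> X \<omega> \<in> {a..b}"
  shows "\<bar>\<alpha> * cvar M \<alpha> X\<bar> \<le> \<bar>a\<bar> + \<bar>b\<bar>"
proof -
  have X_int: "integrable M X"
    by (rule integrable_of_range[OF X ab])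
  obtain \<omega> where "\<omega> \<in> space M" using not_empty by blast
  with ab[of \<omega>] have "a \<le> b" by auto
  have "(\<integral>\<omega>. pos_part (X \<omega> - b) \<partial>M) = (\<integral>\<omega>. 0 \<partial>M)"
    using ab by (intro Bochner_Integration.integral_cong) (auto simp: pos_part_def)
  then have "\<alpha> * cvar M \<alpha> X \<le> \<alpha> * b"
    using cvar_lower[OF assms(1,2) X_int, of b] by simp
  moreover have "\<alpha> * a \<le> \<alpha> * cvar M \<alpha> X"
  proof (rule cvar_greatest[OF \<open>0 < \<alpha>\<close>])
    fix l
    have "\<alpha> * (a - l) \<le> pos_part (X \<omega> - l)" if "\<omega> \<in> space M" for \<omega>
    proof -
      have "\<alpha> * (a - l) \<le> pos_part (a - l)"
        using assms(1,2) mult_right_mono[of \<alpha> 1 "a - l"] mult_nonneg_nonpos[of \<alpha> "a - l"]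
        by (auto simp: pos_part_def max_def)
      also have "\<dots> \<le> pos_part (X \<omega> - l)"
        using ab[OF that] by (intro pos_part_mono) auto
      finally show ?thesis .
    qed
    then have "(\<integral>\<omega>. \<alpha> * (a - l) \<partial>M) \<le> (\<integral>\<omega>. pos_part (X \<omega> - l) \<partial>M)"
      using X_int by (intro integral_mono integrable_pos_part) auto
    then show "\<alpha> * a \<le> \<alpha> * l + (\<integral>\<omega>. pos_part (X \<omega> - l) \<partial>M)"
      by (simp add: prob_space algebra_simps)
  qed
  moreover have "\<alpha> * b \<le> \<bar>a\<bar> + \<bar>b\<bar>" "- (\<bar>a\<bar> + \<bar>b\<bar>) \<le> \<alpha> * a"
  proof -
    have "\<bar>\<alpha> * c\<bar> \<le> \<bar>c\<bar>" for c
      using assms(1,2) by (simp add: abs_mult mult_left_le_one_le)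
    from this[of a] this[of b] show "\<alpha> * b \<le> \<bar>a\<bar> + \<bar>b\<bar>" "- (\<bar>a\<bar> + \<bar>b\<bar>) \<le> \<alpha> * a"
      by linarith+
  qed
  ultimately show ?thesis by linarith
qed

text \<open>\<open>M\<close> carries the variable and \<open>P\<close> the sample, linked only
  through equality of laws. The range conditions hold at every point rather than almost everywhere,
  so deterministic inequalities for empirical measures apply to each outcome.\<close>

locale iid_sample = P: prob_space P + M: prob_space M
  for P :: "'v measure" and M :: "'w measure" +
  fixes n :: nat and X :: "'w \<Rightarrow> real" and Y :: "nat \<Rightarrow> 'v \<Rightarrow> real" and a b :: real
  assumes n: "0 < n"
    and X[measurable]: "X \<in> borel_measurable M"
    and X_ab: "\<And>x. x \<in> space M \<Longrightarrow> X x \<in> {a..b}"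
    and indep: "P.indep_vars (\<lambda>_. borel) Y {1..n}"
    and distr_Y: "\<And>i. i \<in> {1..n} \<Longrightarrow> distr P borel (Y i) = distr M borel X"
    and Y_ab: "\<And>i \<omega>. i \<in> {1..n} \<Longrightarrow> \<omega> \<in> space P \<Longrightarrow> Y i \<omega> \<in> {a..b}"
begin

section \<open>Transfer of expectations from the variable to the sample\<close>

sublocale U: prob_space "uniform_count_measure {1..n}"
  by (rule prob_space_uniform_1_n) (rule n)

lemma Y[measurable]: "i \<in> {1..n} \<Longrightarrow> Y i \<in> borel_measurable P"
  using indep by (simp add: P.indep_vars_def)

lemma X_int: "integrable M X"
  by (rule M.integrable_of_range[OF X X_ab])

lemma expectation_Y:
  assumes "i \<in> {1..n}" and [measurable]: "h \<in> borel_measurable borel"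
  shows "P.expectation (\<lambda>\<omega>. h (Y i \<omega>) :: real) = M.expectation (\<lambda>x. h (X x))"
proof -
  have "P.expectation (\<lambda>\<omega>. h (Y i \<omega>)) = (\<integral>x. h x \<partial>distr P borel (Y i))"
    using assms by (intro integral_distr[symmetric]) auto
  also have "\<dots> = M.expectation (\<lambda>x. h (X x))"
    unfolding distr_Y[OF assms(1)] by (intro integral_distr) auto
  finally show ?thesis .
qed

lemma integrable_Y:
  assumes "i \<in> {1..n}" and [measurable]: "h \<in> borel_measurable borel"
    and "integrable M (\<lambda>x. h (X x))"
  shows "integrable P (\<lambda>\<omega>. h (Y i \<omega>) :: real)"
proof -
  have "integrable (distr M borel X) h"
    using assms by (subst integrable_distr_eq) auto
  then have "integrable (distr P borel (Y i)) h"
    by (simp add: distr_Y[OF assms(1)])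
  then show ?thesis
    using assms by (subst (asm) integrable_distr_eq) auto
qed

lemma
  assumes [measurable]: "h \<in> borel_measurable borel" and h: "integrable M (\<lambda>x. h (X x) :: real)"
  shows integrable_empirical_mean: "integrable P (\<lambda>\<omega>. (\<Sum>i=1..n. h (Y i \<omega>)) / n)"
    and expectation_empirical_mean:
      "P.expectation (\<lambda>\<omega>. (\<Sum>i=1..n. h (Y i \<omega>)) / n) = M.expectation (\<lambda>x. h (X x))"
proof -
  have int: "integrable P (\<lambda>\<omega>. h (Y i \<omega>))" if "i \<in> {1..n}" for i
    using that h by (intro integrable_Y) auto
  then show "integrable P (\<lambda>\<omega>. (\<Sum>i=1..n. h (Y i \<omega>)) / n)"
    by (intro integrable_divide Bochner_Integration.integrable_sum)
  have "P.expectation (\<lambda>\<omega>. (\<Sum>i=1..n. h (Y i \<omega>)) / n) = (\<Sum>i=1..n. P.expectation (\<lambda>\<omega>. h (Y i \<omega>))) / n"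
    using Bochner_Integration.integral_sum[of "{1..n}" P "\<lambda>i \<omega>. h (Y i \<omega>)"] int by simp
  also have "(\<Sum>i=1..n. P.expectation (\<lambda>\<omega>. h (Y i \<omega>))) = (\<Sum>i=1..n. M.expectation (\<lambda>x. h (X x)))"
    by (intro sum.cong refl expectation_Y) auto
  also have "\<dots> / n = M.expectation (\<lambda>x. h (X x))"
    using n by simp
  finally show "P.expectation (\<lambda>\<omega>. (\<Sum>i=1..n. h (Y i \<omega>)) / n) = M.expectation (\<lambda>x. h (X x))" .
qed

section \<open>Two-sided control of the bias of the scaled empirical CVaR\<close>

definition Chat :: "real \<Rightarrow> 'v \<Rightarrow> real" where
  "Chat \<alpha> \<omega> = \<alpha> * empirical_cvar n \<alpha> (\<lambda>i. Y i \<omega>)"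

lemma Chat_measurable: "0 < \<alpha> \<Longrightarrow> \<alpha> \<le> 1 \<Longrightarrow> Chat \<alpha> \<in> borel_measurable P"
  unfolding Chat_def[abs_def] by (intro empirical_cvar_measurable n) auto

lemma Chat_int:
  assumes "0 < \<alpha>" "\<alpha> \<le> 1"
  shows "integrable P (Chat \<alpha>)"
proof (rule P.integrable_const_bound[OF _ Chat_measurable[OF assms]])
  have "\<bar>Chat \<alpha> \<omega>\<bar> \<le> \<bar>a\<bar> + \<bar>b\<bar>" if "\<omega> \<in> space P" for \<omega>
    unfolding Chat_def empirical_cvar_eq_cvar
    using assms Y_ab that
    by (intro U.cvar_bounds)
      (auto simp: space_uniform_count_measure measurable_def sets_uniform_count_measure)
  then show "AE \<omega> in P. norm (Chat \<alpha> \<omega>) \<le> \<bar>a\<bar> + \<bar>b\<bar>" by auto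
qed

text \<open>At each fixed \<open>l\<close> the empirical objective lies above \<open>Chat\<close>
  and has the true objective as its mean; the infimum over \<open>l\<close> is taken last.\<close>

lemma expectation_Chat_le:
  assumes \<alpha>: "0 < \<alpha>" "\<alpha> \<le> 1"
  shows "P.expectation (Chat \<alpha>) \<le> \<alpha> * cvar M \<alpha> X"
proof (rule M.cvar_greatest[OF \<alpha>(1)])
  fix l
  have int: "integrable P (\<lambda>\<omega>. (\<Sum>i=1..n. pos_part (Y i \<omega> - l)) / n)"
    by (intro integrable_empirical_mean M.integrable_pos_part X_int) auto
  have "P.expectation (Chat \<alpha>) \<le> P.expectation (\<lambda>\<omega>. \<alpha> * l + (\<Sum>i=1..n. pos_part (Y i \<omega> - l)) / n)"
  proof (intro integral_mono Chat_int \<alpha> Bochner_Integration.integrable_add int)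
    show "Chat \<alpha> \<omega> \<le> \<alpha> * l + (\<Sum>i=1..n. pos_part (Y i \<omega> - l)) / n" for \<omega>
      using U.cvar_lower[OF \<alpha> integrable_uniform_count_measure, of "\<lambda>i. Y i \<omega>" l]
      by (simp add: Chat_def empirical_cvar_eq_cvar integral_uniform_count_measure)
  qed auto
  also have "\<dots> = \<alpha> * l + P.expectation (\<lambda>\<omega>. (\<Sum>i=1..n. pos_part (Y i \<omega> - l)) / n)"
    by (subst Bochner_Integration.integral_add[OF _ int]) (auto simp: P.prob_space)
  also have "P.expectation (\<lambda>\<omega>. (\<Sum>i=1..n. pos_part (Y i \<omega> - l)) / n)
      = M.expectation (\<lambda>x. pos_part (X x - l))"
    by (intro expectation_empirical_mean M.integrable_pos_part X_int) auto
  finally show "P.expectation (Chat \<alpha>) \<le> \<alpha> * l + M.expectation (\<lambda>x. pos_part (X x - l))" .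
qed

text \<open>\<open>cvar_ge_at_level\<close> is applied to the empirical measure of each outcome at
  the true quantile \<open>q\<close> and then averaged. The empirical objective at \<open>q\<close>
  has the true objective as its mean, hence at least the scaled CVaR; the averaged error is governed
  by the second moments of the centred indicators \<open>Z i\<close>.\<close>

lemma expectation_Chat_ge:
  assumes \<alpha>: "0 < \<alpha>" "\<alpha> \<le> 1" and q: "q \<in> {a..b}"
    and level: "M.prob {x\<in>space M. q < X x} = \<alpha>"
  shows "\<alpha> * cvar M \<alpha> X - (b - a) * sqrt (\<alpha> / n) \<le> P.expectation (Chat \<alpha>)"
proof -
  define Z where "Z i \<omega> = indicator {q<..} (Y i \<omega>) - \<alpha>" for i \<omega>
  have h[measurable]: "(\<lambda>x. indicator {q<..} x - \<alpha>) \<in> borel_measurable borel"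
    by measurable
  have ind_X: "M.expectation (\<lambda>x. indicator {q<..} (X x) :: real) = \<alpha>"
  proof -
    have "M.expectation (\<lambda>x. indicator {q<..} (X x) :: real) = M.expectation (indicator {x\<in>space M. q < X x})"
      by (intro Bochner_Integration.integral_cong) (auto simp: indicator_def)
    then show ?thesis using level by simp
  qed
  have ind_int: "integrable M (\<lambda>x. indicator {q<..} (X x) :: real)"
    by (rule M.integrable_const_bound[of _ 1]) (auto simp: indicator_def)
  \<comment> \<open>An indicator equals its square, so the squared deviation is affine in it; its
    mean becomes the Bernoulli variance \<open>\<alpha> * (1 - \<alpha>)\<close>, at most
    \<alpha>.\<close>
  have sq: "(indicator {q<..} x - \<alpha>)\<^sup>2 = (1 - 2 * \<alpha>) * indicator {q<..} x + \<alpha>\<^sup>2" for x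
    by (auto simp: indicator_def power2_eq_square algebra_simps)
  have Z_int: "integrable P (Z i)" if "i \<in> {1..n}" for i
    unfolding Z_def[abs_def] using that ind_int
    by (intro integrable_Y[where h = "\<lambda>x. indicator {q<..} x - \<alpha>"]) auto
  have abs_Z: "P.expectation (\<lambda>\<omega>. \<bar>\<Sum>i=1..n. Z i \<omega>\<bar>) \<le> sqrt (real (card {1..n}) * \<alpha>)"
  proof (rule P.expectation_abs_sum_le)
    show "P.indep_vars (\<lambda>_. borel) Z {1..n}"
      unfolding Z_def[abs_def] by (rule P.indep_vars_compose2[OF indep]) measurable
    fix i assume i: "i \<in> {1..n}"
    show "integrable P (\<lambda>\<omega>. (Z i \<omega>)\<^sup>2)"
      unfolding Z_def using i ind_int
      by (intro integrable_Y[where h = "\<lambda>x. (indicator {q<..} x - \<alpha>)\<^sup>2"]) (auto simp: sq)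
    show "P.expectation (Z i) = 0"
      unfolding Z_def[abs_def] using i ind_int ind_X
      by (subst expectation_Y[where h = "\<lambda>x. indicator {q<..} x - \<alpha>"]) (auto simp: M.prob_space)
    have "P.expectation (\<lambda>\<omega>. (Z i \<omega>)\<^sup>2) = (1 - 2 * \<alpha>) * \<alpha> + \<alpha>\<^sup>2"
      unfolding Z_def using i ind_int ind_X
      by (subst expectation_Y[where h = "\<lambda>x. (indicator {q<..} x - \<alpha>)\<^sup>2"]) (auto simp: sq M.prob_space)
    also have "\<dots> \<le> \<alpha>"
      using \<alpha> by (simp add: power2_eq_square algebra_simps)
    finally show "P.expectation (\<lambda>\<omega>. (Z i \<omega>)\<^sup>2) \<le> \<alpha>" .
  qed simp
  have int: "integrable P (\<lambda>\<omega>. (\<Sum>i=1..n. pos_part (Y i \<omega> - q)) / n)"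
    by (intro integrable_empirical_mean M.integrable_pos_part X_int) auto
  have abs_int: "integrable P (\<lambda>\<omega>. \<bar>\<Sum>i=1..n. Z i \<omega>\<bar>)"
    using Z_int by (intro integrable_abs Bochner_Integration.integrable_sum)
  have ab: "0 \<le> b - a" using q by auto
  have "\<alpha> * cvar M \<alpha> X \<le> \<alpha> * q + M.expectation (\<lambda>x. pos_part (X x - q))"
    by (rule M.cvar_lower[OF \<alpha> X_int])
  also have "M.expectation (\<lambda>x. pos_part (X x - q))
      = P.expectation (\<lambda>\<omega>. (\<Sum>i=1..n. pos_part (Y i \<omega> - q)) / n)"
    by (intro expectation_empirical_mean[symmetric] M.integrable_pos_part X_int) auto
  finally have "\<alpha> * cvar M \<alpha> X - (b - a) * (P.expectation (\<lambda>\<omega>. \<bar>\<Sum>i=1..n. Z i \<omega>\<bar>) / n)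
      \<le> \<alpha> * q + P.expectation (\<lambda>\<omega>. (\<Sum>i=1..n. pos_part (Y i \<omega> - q)) / n)
        - P.expectation (\<lambda>\<omega>. (b - a) * (\<bar>\<Sum>i=1..n. Z i \<omega>\<bar> / n))"
    by simp
  also have "\<dots> = P.expectation (\<lambda>\<omega>. \<alpha> * q + (\<Sum>i=1..n. pos_part (Y i \<omega> - q)) / n
          - (b - a) * (\<bar>\<Sum>i=1..n. Z i \<omega>\<bar> / n))"
  proof -
    have abs_int': "integrable P (\<lambda>\<omega>. (b - a) * (\<bar>\<Sum>i=1..n. Z i \<omega>\<bar> / n))"
      by (intro integrable_mult_right integrable_divide abs_int)
    have "integrable P (\<lambda>\<omega>. \<alpha> * q + (\<Sum>i=1..n. pos_part (Y i \<omega> - q)) / n)"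
      by (intro Bochner_Integration.integrable_add int) auto
    from Bochner_Integration.integral_diff[OF this abs_int'] show ?thesis
      using Bochner_Integration.integral_add[OF _ int, of "\<lambda>_. \<alpha> * q"] by (simp add: P.prob_space)
  qed
  also have "\<dots> \<le> P.expectation (Chat \<alpha>)"
  proof (intro integral_mono Chat_int \<alpha> Bochner_Integration.integrable_diff
      Bochner_Integration.integrable_add int integrable_divide integrable_mult_right abs_int)
    fix \<omega> assume \<omega>: "\<omega> \<in> space P"
    \<comment> \<open>The uniform probability of the indices above \<open>q\<close> is their
      fraction, so its error is the average of the \<open>Z i\<close>.\<close>
    have "U.prob {i \<in> space (uniform_count_measure {1..n}). q < Y i \<omega>} - \<alpha> = (\<Sum>i=1..n. Z i \<omega>) / n"
    proof -
      have "{i \<in> {1..n}. q < Y i \<omega>} = {1..n} \<inter> {i. q < Y i \<omega>}" by auto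
      then have "(\<Sum>i=1..n. indicator {q<..} (Y i \<omega>) :: real) = real (card {i \<in> {1..n}. q < Y i \<omega>})"
        by (simp add: indicator_def of_bool_def sum.If_cases)
      moreover have "U.prob {i \<in> {1..n}. q < Y i \<omega>} = real (card {i \<in> {1..n}. q < Y i \<omega>}) / n"
        by (subst measure_uniform_count_measure) auto
      ultimately show ?thesis
        using n by (simp add: Z_def sum_subtractf field_simps space_uniform_count_measure)
    qed
    then have "\<bar>U.prob {i \<in> space (uniform_count_measure {1..n}). q < Y i \<omega>} - \<alpha>\<bar>
        = \<bar>\<Sum>i=1..n. Z i \<omega>\<bar> / n"
      by simp
    moreover have "\<alpha> * q + (\<integral>i. pos_part (Y i \<omega> - q) \<partial>uniform_count_measure {1..n})
        - (b - a) * \<bar>U.prob {i \<in> space (uniform_count_measure {1..n}). q < Y i \<omega>} - \<alpha>\<bar>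
        \<le> \<alpha> * cvar (uniform_count_measure {1..n}) \<alpha> (\<lambda>i. Y i \<omega>)"
      using Y_ab \<omega> q \<alpha>
      by (intro U.cvar_ge_at_level)
        (auto simp: space_uniform_count_measure measurable_def sets_uniform_count_measure)
    ultimately show "\<alpha> * q + (\<Sum>i=1..n. pos_part (Y i \<omega> - q)) / n
        - (b - a) * (\<bar>\<Sum>i=1..n. Z i \<omega>\<bar> / n) \<le> Chat \<alpha> \<omega>"
      by (simp add: Chat_def empirical_cvar_eq_cvar integral_uniform_count_measure)
  qed auto
  finally have "\<alpha> * cvar M \<alpha> X - (b - a) * (P.expectation (\<lambda>\<omega>. \<bar>\<Sum>i=1..n. Z i \<omega>\<bar>) / n)
      \<le> P.expectation (Chat \<alpha>)" by simp
  moreover have "P.expectation (\<lambda>\<omega>. \<bar>\<Sum>i=1..n. Z i \<omega>\<bar>) / n \<le> sqrt (real n * \<alpha>) / n"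
    using abs_Z n by (intro divide_right_mono) auto
  moreover have "sqrt (real n * \<alpha>) / n = sqrt (\<alpha> / n)"
    using n by (simp add: real_sqrt_mult real_sqrt_divide field_simps)
  ultimately show ?thesis
    using mult_left_mono[OF _ ab] by smt
qed

end

section \<open>Concentration of the difference of two levels\<close>

text \<open>For \<open>a \<le> b\<close> this is the projection onto the interval. It turns
  almost-sure range conditions into pointwise ones and extends functions of bounded samples to all
  real vectors.\<close>

definition clamp :: "real \<Rightarrow> real \<Rightarrow> real \<Rightarrow> real" where
  "clamp a b x = max a (min b x)"

lemma clamp_measurable[measurable]: "clamp a b \<in> borel_measurable borel"
  unfolding clamp_def[abs_def] by measurable

lemma clamp_in: "a \<le> b \<Longrightarrow> clamp a b x \<in> {a..b}"
  by (auto simp: clamp_def)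

lemma clamp_id: "x \<in> {a..b} \<Longrightarrow> clamp a b x = x"
  by (auto simp: clamp_def)

lemma empirical_cvar_cong:
  "(\<And>i. i \<in> {1..n} \<Longrightarrow> x i = y i) \<Longrightarrow> empirical_cvar n \<alpha> x = empirical_cvar n \<alpha> y"
  by (simp add: empirical_cvar_def)

text \<open>The first claim is \<open>cvar_supermodular\<close> rearranged. For the second, the
  \<alpha> term grows by at most the mean increase and the subtracted \<beta> term does not fall; so
  the two levels do not add up their sensitivities.\<close>

lemma empirical_cvar_difference_mono:
  fixes x y :: "nat \<Rightarrow> real"
  assumes n: "0 < n" and \<alpha>: "0 < \<beta>" "\<beta> \<le> \<alpha>" "\<alpha> \<le> 1"
    and le: "\<And>i. i \<in> {1..n} \<Longrightarrow> x i \<le> y i"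
  defines "W \<equiv> \<lambda>x. \<alpha> * empirical_cvar n \<alpha> x - \<beta> * empirical_cvar n \<beta> x"
  shows "W x \<le> W y" and "W y - W x \<le> (\<Sum>i=1..n. y i - x i) / n"
proof -
  interpret U: prob_space "uniform_count_measure {1..n}"
    by (rule prob_space_uniform_1_n) (rule n)
  have int: "integrable (uniform_count_measure {1..n}) z" for z :: "nat \<Rightarrow> real"
    by (rule integrable_uniform_count_measure) simp
  have le': "x i \<le> y i" if "i \<in> space (uniform_count_measure {1..n})" for i
    using le that by (simp add: space_uniform_count_measure)
  show "W x \<le> W y"
    using U.cvar_supermodular[of \<beta> \<alpha> x y, OF \<alpha> int int le'] by (simp add: W_def empirical_cvar_eq_cvar)
  show "W y - W x \<le> (\<Sum>i=1..n. y i - x i) / n"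
  proof -
    have "\<beta> * empirical_cvar n \<beta> x \<le> \<beta> * empirical_cvar n \<beta> y"
      unfolding empirical_cvar_eq_cvar using \<alpha> by (intro U.cvar_mono int le') auto
    moreover have "\<alpha> * empirical_cvar n \<alpha> y - \<alpha> * empirical_cvar n \<alpha> x \<le> (\<Sum>i=1..n. y i - x i) / n"
      using U.cvar_diff_le[of \<alpha> x y, OF _ _ int int le'] \<alpha>
      by (simp add: empirical_cvar_eq_cvar integral_uniform_count_measure)
    ultimately show ?thesis
      unfolding W_def by linarith
  qed
qed

text \<open>An upward update is a comparison of ordered vectors differing in one entry; a downward
  update is an upward one read backwards.\<close>

lemma empirical_cvar_difference_update:
  fixes x :: "nat \<Rightarrow> real"
  assumes n: "0 < n" and \<alpha>: "0 < \<beta>" "\<beta> \<le> \<alpha>" "\<alpha> \<le> 1" and i: "i \<in> {1..n}"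
  defines "W \<equiv> \<lambda>x. \<alpha> * empirical_cvar n \<alpha> x - \<beta> * empirical_cvar n \<beta> x"
  shows "\<bar>W (x(i := y)) - W x\<bar> \<le> \<bar>y - x i\<bar> / n"
proof -
  have *: "\<bar>W (x(i := y)) - W x\<bar> \<le> \<bar>y - x i\<bar> / n" if "x i \<le> y" for x y
  proof -
    have "(\<Sum>j=1..n. (x(i := y)) j - x j) = (\<Sum>j=1..n. if j = i then y - x i else 0)"
      by (intro sum.cong) auto
    also have "\<dots> = y - x i"
      using i by simp
    finally show ?thesis
      using empirical_cvar_difference_mono[OF n \<alpha>, of x "x(i := y)"] that by (auto simp: W_def)
  qed
  show ?thesis
  proof (cases "x i \<le> y")
    case False
    then show ?thesis using *[of "x(i := y)" "x i"] by (simp add: abs_minus_commute)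
  qed (rule *)
qed

section \<open>Tails around the mean, then bias and tails combined\<close>

context iid_sample
begin

text \<open>McDiarmid's inequality with every \<open>c i\<close> equal to
  \<open>(b - a) / n\<close>, whose squares sum to \<open>(b - a)\<^sup>2 / n\<close>. The lower
  tail is the upper tail of the negated function.\<close>

lemma Chat_difference_tails:
  fixes \<epsilon> :: real
  assumes \<alpha>: "0 < \<beta>" "\<beta> \<le> \<alpha>" "\<alpha> \<le> 1" and ab: "a < b" and \<epsilon>: "\<epsilon> > 0"
  defines "Z \<equiv> \<lambda>\<omega>. Chat \<alpha> \<omega> - Chat \<beta> \<omega>"
  shows "P.prob {\<omega>\<in>space P. Z \<omega> \<ge> P.expectation Z + \<epsilon>} \<le> exp (- 2 * n * \<epsilon>\<^sup>2 / (b - a)\<^sup>2)"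
    and "P.prob {\<omega>\<in>space P. Z \<omega> \<le> P.expectation Z - \<epsilon>} \<le> exp (- 2 * n * \<epsilon>\<^sup>2 / (b - a)\<^sup>2)"
proof -
  define W where "W x = \<alpha> * empirical_cvar n \<alpha> x - \<beta> * empirical_cvar n \<beta> x" for x
  \<comment> \<open>McDiarmid's inequality asks for bounds on the whole product space, here all real
    vectors; clamping provides them and changes nothing on the actual sample.\<close>
  define f where "f x = W (\<lambda>i. clamp a b (x i))" for x
  have \<alpha>': "0 < \<alpha>" "\<beta> \<le> 1" using \<alpha> by auto
  have f_meas[measurable]: "f \<in> borel_measurable (Pi\<^sub>M {1..n} (\<lambda>_. borel))"
    unfolding f_def W_def using \<alpha> \<alpha>'
    by (intro borel_measurable_diff empirical_cvar_measurable n) auto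
  have f_bound: "\<bar>f x\<bar> \<le> 2 * (\<bar>a\<bar> + \<bar>b\<bar>)" for x
  proof -
    have "\<bar>\<gamma> * empirical_cvar n \<gamma> (\<lambda>i. clamp a b (x i))\<bar> \<le> \<bar>a\<bar> + \<bar>b\<bar>" if "0 < \<gamma>" "\<gamma> \<le> 1" for \<gamma>
      unfolding empirical_cvar_eq_cvar using that ab
      by (intro U.cvar_bounds clamp_in)
        (auto simp: space_uniform_count_measure measurable_def sets_uniform_count_measure)
    from this[of \<alpha>] this[of \<beta>] show ?thesis
      using \<alpha> \<alpha>' by (simp add: f_def W_def)
  qed
  have f_diff: "\<bar>f (x(i := y)) - f x\<bar> \<le> (b - a) / n" if i: "i \<in> {1..n}" for x i y
  proof -
    have "(\<lambda>j. clamp a b ((x(i := y)) j)) = (\<lambda>j. clamp a b (x j))(i := clamp a b y)"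
      by auto
    then have "\<bar>f (x(i := y)) - f x\<bar> \<le> \<bar>clamp a b y - clamp a b (x i)\<bar> / n"
      using empirical_cvar_difference_update[OF n \<alpha> i, of "\<lambda>j. clamp a b (x j)" "clamp a b y"]
      by (simp add: f_def W_def)
    also have "\<dots> \<le> (b - a) / n"
      using clamp_in[of a b y] clamp_in[of a b "x i"] ab by (intro divide_right_mono) auto
    finally show ?thesis .
  qed
  have Z: "Z \<omega> = f (\<lambda>i\<in>{1..n}. Y i \<omega>)" if "\<omega> \<in> space P" for \<omega>
    unfolding Z_def Chat_def f_def W_def
    using that Y_ab by (intro arg_cong2[of _ _ _ _ "(-)"] arg_cong2[of _ _ _ _ "(*)"] refl
        empirical_cvar_cong) (auto simp: clamp_id)
  have EZ: "P.expectation Z = P.expectation (\<lambda>\<omega>. f (\<lambda>i\<in>{1..n}. Y i \<omega>))"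
    by (intro Bochner_Integration.integral_cong) (auto simp: Z)
  have sq: "(\<Sum>i\<in>{1..n}. ((b - a) / n)\<^sup>2) = (b - a)\<^sup>2 / n"
    using n by (simp add: power2_eq_square)
  have pos: "(\<Sum>i\<in>{1..n}. ((b - a) / n)\<^sup>2) > 0"
    unfolding sq using n ab by simp
  have ex: "exp (- 2 * \<epsilon>\<^sup>2 / (\<Sum>i\<in>{1..n}. ((b - a) / n)\<^sup>2)) = exp (- 2 * n * \<epsilon>\<^sup>2 / (b - a)\<^sup>2)"
    unfolding sq by simp
  have "P.prob {\<omega>\<in>space P. f (\<lambda>i\<in>{1..n}. Y i \<omega>) \<ge> P.expectation (\<lambda>\<omega>. f (\<lambda>i\<in>{1..n}. Y i \<omega>)) + \<epsilon>}
      \<le> exp (- 2 * \<epsilon>\<^sup>2 / (\<Sum>i\<in>{1..n}. ((b - a) / n)\<^sup>2))"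
    by (intro P.McDiarmid_ineq_ge[where N = "\<lambda>_. borel" and B = "2 * (\<bar>a\<bar> + \<bar>b\<bar>)"] indep f_meas f_bound
        f_diff pos \<epsilon>) auto
  then show "P.prob {\<omega>\<in>space P. Z \<omega> \<ge> P.expectation Z + \<epsilon>} \<le> exp (- 2 * n * \<epsilon>\<^sup>2 / (b - a)\<^sup>2)"
    unfolding ex EZ[symmetric] by (simp add: Z cong: conj_cong)
  have "P.prob {\<omega>\<in>space P. - f (\<lambda>i\<in>{1..n}. Y i \<omega>) \<ge> P.expectation (\<lambda>\<omega>. - f (\<lambda>i\<in>{1..n}. Y i \<omega>)) + \<epsilon>}
      \<le> exp (- 2 * \<epsilon>\<^sup>2 / (\<Sum>i\<in>{1..n}. ((b - a) / n)\<^sup>2))"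
  proof (intro P.McDiarmid_ineq_ge[where f = "\<lambda>x. - f x" and N = "\<lambda>_. borel" and B = "2 * (\<bar>a\<bar> + \<bar>b\<bar>)"]
      indep pos \<epsilon>)
    show "\<bar>- f (x(i := y)) - - f x\<bar> \<le> (b - a) / n" if "i \<in> {1..n}" for x i y
      using f_diff[OF that, of x y] by (simp add: abs_minus_commute)
  qed (use f_meas f_bound in \<open>auto simp del: One_nat_def\<close>)
  then show "P.prob {\<omega>\<in>space P. Z \<omega> \<le> P.expectation Z - \<epsilon>} \<le> exp (- 2 * n * \<epsilon>\<^sup>2 / (b - a)\<^sup>2)"
    unfolding ex by (simp add: Z EZ[symmetric] le_diff_eq algebra_simps del: One_nat_def cong: conj_cong)
qed

text \<open>\<open>L - Z\<close> is split into the bias \<open>L - P.expectation Z\<close> and a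
  centred deviation. The empirical terms have one-sided bias, so in each direction one of the two
  biases has a favourable sign: only \<alpha> enters the upper bound and only \<beta> the lower
  one.\<close>

lemma Chat_difference_deviation:
  assumes \<alpha>: "0 < \<beta>" "\<beta> \<le> \<alpha>" "\<alpha> \<le> 1" and ab: "a < b" and \<delta>: "0 < \<delta>" "\<delta> \<le> 1"
    and quantile: "\<And>\<gamma>. 0 < \<gamma> \<Longrightarrow> \<gamma> \<le> 1 \<Longrightarrow> \<exists>q\<in>{a..b}. M.prob {x\<in>space M. q < X x} = \<gamma>"
  defines "Z \<equiv> \<lambda>\<omega>. Chat \<alpha> \<omega> - Chat \<beta> \<omega>"
    and "L \<equiv> \<alpha> * cvar M \<alpha> X - \<beta> * cvar M \<beta> X"
    and "t \<equiv> sqrt (ln (1 / \<delta>) / (2 * real n))"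
  shows "1 - \<delta> \<le> P.prob {\<omega>\<in>space P. L - Z \<omega> \<le> (b - a) * (sqrt (\<alpha> / n) + t)}"
    and "1 - \<delta> \<le> P.prob {\<omega>\<in>space P. L - Z \<omega> \<ge> - (b - a) * (sqrt (\<beta> / n) + t)}"
proof -
  have \<alpha>': "0 < \<alpha>" "\<beta> \<le> 1" using \<alpha> by auto
  note Chat_measurable[OF \<alpha>'(1) \<alpha>(3), measurable] Chat_measurable[OF \<alpha>(1) \<alpha>'(2), measurable]
  have Z[measurable]: "Z \<in> borel_measurable P"
    unfolding Z_def by measurable
  have EZ: "P.expectation Z = P.expectation (Chat \<alpha>) - P.expectation (Chat \<beta>)"
    unfolding Z_def using \<alpha> \<alpha>' by (intro Bochner_Integration.integral_diff Chat_int) auto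
  obtain q where q: "q \<in> {a..b}" "M.prob {x\<in>space M. q < X x} = \<alpha>"
    using quantile \<alpha> \<alpha>' by blast
  obtain r where r: "r \<in> {a..b}" "M.prob {x\<in>space M. r < X x} = \<beta>"
    using quantile \<alpha> \<alpha>' by blast
  have lower: "L - P.expectation Z \<le> (b - a) * sqrt (\<alpha> / n)"
    using expectation_Chat_ge[OF \<alpha>'(1) \<alpha>(3) q] expectation_Chat_le[OF \<alpha>(1) \<alpha>'(2)]
    by (simp add: L_def EZ)
  have upper: "- (b - a) * sqrt (\<beta> / n) \<le> L - P.expectation Z"
    using expectation_Chat_ge[OF \<alpha>(1) \<alpha>'(2) r] expectation_Chat_le[OF \<alpha>'(1) \<alpha>(3)]
    by (simp add: L_def EZ algebra_simps)
  define A where "A = {\<omega>\<in>space P. L - Z \<omega> \<le> (b - a) * (sqrt (\<alpha> / n) + t)}"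
  define B where "B = {\<omega>\<in>space P. L - Z \<omega> \<ge> - (b - a) * (sqrt (\<beta> / n) + t)}"
  have [measurable]: "A \<in> P.events" "B \<in> P.events"
    unfolding A_def B_def by measurable
  have "1 - \<delta> \<le> P.prob A \<and> 1 - \<delta> \<le> P.prob B"
  \<comment> \<open>At \<delta> = 1 the deviation would be 0, which the tail bound excludes, but
    then the claim is only that probabilities are nonnegative.\<close>
  proof (cases "\<delta> = 1")
    case False
    then have ln: "ln (1 / \<delta>) > 0" using \<delta> by simp
    \<comment> \<open>Chosen so that the tail bound equals \<delta> exactly.\<close>
    define \<epsilon> where "\<epsilon> = (b - a) * t"
    have \<epsilon>: "\<epsilon> > 0"
      using ln n ab by (simp add: \<epsilon>_def t_def)
    have "\<epsilon>\<^sup>2 = (b - a)\<^sup>2 * (ln (1 / \<delta>) / (2 * n))"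
      using ln by (simp add: \<epsilon>_def t_def power_mult_distrib)
    then have "- 2 * n * \<epsilon>\<^sup>2 / (b - a)\<^sup>2 = ln \<delta>"
      using n ab \<delta> by (simp add: ln_div)
    then have ex: "exp (- 2 * n * \<epsilon>\<^sup>2 / (b - a)\<^sup>2) = \<delta>"
      using \<delta> by simp
    have tails: "P.prob {\<omega>\<in>space P. Z \<omega> \<ge> P.expectation Z + \<epsilon>} \<le> \<delta>"
      "P.prob {\<omega>\<in>space P. Z \<omega> \<le> P.expectation Z - \<epsilon>} \<le> \<delta>"
      using Chat_difference_tails[OF \<alpha> ab \<epsilon>] unfolding ex Z_def by auto
    have "space P - A \<subseteq> {\<omega>\<in>space P. Z \<omega> \<le> P.expectation Z - \<epsilon>}"
      using lower by (auto simp: A_def \<epsilon>_def algebra_simps)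
    then have "P.prob (space P - A) \<le> P.prob {\<omega>\<in>space P. Z \<omega> \<le> P.expectation Z - \<epsilon>}"
      by (rule P.finite_measure_mono) measurable
    moreover have "space P - B \<subseteq> {\<omega>\<in>space P. Z \<omega> \<ge> P.expectation Z + \<epsilon>}"
      using upper by (auto simp: B_def \<epsilon>_def algebra_simps)
    then have "P.prob (space P - B) \<le> P.prob {\<omega>\<in>space P. Z \<omega> \<ge> P.expectation Z + \<epsilon>}"
      by (rule P.finite_measure_mono) measurable
    ultimately show ?thesis
      using tails P.prob_compl[of A] P.prob_compl[of B] by force
  qed simp
  then show "1 - \<delta> \<le> P.prob {\<omega>\<in>space P. L - Z \<omega> \<le> (b - a) * (sqrt (\<alpha> / n) + t)}"
    and "1 - \<delta> \<le> P.prob {\<omega>\<in>space P. L - Z \<omega> \<ge> - (b - a) * (sqrt (\<beta> / n) + t)}"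
    unfolding A_def B_def by auto
qed

end

section \<open>Support and quantiles\<close>

text \<open>The complement of the support is the union of all open null sets. This family may be
  uncountable; the Lindelof property gives a countable subfamily with the same union.\<close>

lemma (in prob_space) AE_in_law_support:
  assumes X[measurable]: "X \<in> borel_measurable M"
  shows "AE x in distr M borel X. x \<in> law_support M X"
proof -
  let ?D = "distr M borel X"
  interpret D: prob_space ?D
    by (rule prob_space_distr) fact
  define F where "F = {U. open U \<and> measure ?D U = 0}"
  obtain F' where F': "F' \<subseteq> F" "countable F'" "\<Union>F' = \<Union>F"
    by (rule Lindelof[of F]) (auto simp: F_def)
  have "AE x in ?D. \<forall>U\<in>F'. x \<notin> U"
  proof (rule AE_ball_countable[THEN iffD2, OF F'(2)], rule ballI)
    fix U assume "U \<in> F'"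
    with F'(1) have "open U" "measure ?D U = 0" by (auto simp: F_def)
    then show "AE x in ?D. x \<notin> U"
      by (intro AE_not_in) (auto simp: null_sets_def D.emeasure_eq_measure)
  qed
  then show ?thesis
  proof (rule eventually_mono)
    fix x assume "\<forall>U\<in>F'. x \<notin> U"
    then have "x \<notin> \<Union>F" using F'(3) by auto
    then show "x \<in> law_support M X"
      by (auto simp: F_def law_support_def zero_less_measure_iff)
  qed
qed

text \<open>Continuity excludes an atom at \<open>a\<close>, so the distribution function rises from
  0 at \<open>a\<close> to 1 at \<open>b\<close> and attains 1 - \<alpha> in between. The point is
  strictly below \<open>b\<close> because \<alpha> > 0; this strictness makes the quantile survive
  clamping.\<close>

lemma (in prob_space) quantile_of_continuous_cdf:
  fixes X :: "'a \<Rightarrow> real"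
  assumes X[measurable]: "X \<in> borel_measurable M" and ae: "AE x in M. X x \<in> {a..b}"
    and cont: "continuous_on UNIV (cdf (distr M borel X))"
  shows "a < b"
    and "0 < \<alpha> \<Longrightarrow> \<alpha> \<le> 1 \<Longrightarrow> \<exists>q\<in>{a..<b}. prob {x\<in>space M. q < X x} = \<alpha>"
proof -
  interpret D: real_distribution "distr M borel X"
    by simp
  have cdf: "cdf (distr M borel X) t = prob {x\<in>space M. X x \<le> t}" for t
    unfolding cdf_def by (subst measure_distr) (auto intro!: arg_cong[where f = prob])
  have "measure (distr M borel X) {a} = 0"
    using cont D.isCont_cdf[of a] by (auto simp: continuous_on_eq_continuous_at)
  then have "prob {x\<in>space M. X x = a} = 0"
    by (subst (asm) measure_distr) (auto simp: vimage_def Int_def conj_commute)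
  then have ne: "AE x in M. X x \<noteq> a"
    by (subst (asm) prob_eq_0) auto
  have "prob {x\<in>space M. X x \<le> a} = 0"
    using ae ne by (subst prob_eq_0) auto
  then have cdf_a: "cdf (distr M borel X) a = 0" by (simp add: cdf)
  have "prob {x\<in>space M. X x \<le> b} = 1"
    using ae by (subst prob_eq_1) auto
  then have cdf_b: "cdf (distr M borel X) b = 1" by (simp add: cdf)
  show "a < b"
    using D.cdf_nondecreasing[of b a] cdf_a cdf_b by (cases "a < b") auto
  assume \<alpha>: "0 < \<alpha>" "\<alpha> \<le> 1"
  obtain q where q: "a \<le> q" "q \<le> b" "cdf (distr M borel X) q = 1 - \<alpha>"
    using IVT'[of "cdf (distr M borel X)" a "1 - \<alpha>" b] cdf_a cdf_b \<alpha> \<open>a < b\<close>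
      continuous_on_subset[OF cont] by auto
  have "q \<noteq> b" using q(3) cdf_b \<alpha> by auto
  have "{x\<in>space M. q < X x} = space M - {x\<in>space M. X x \<le> q}" by auto
  then have "prob {x\<in>space M. q < X x} = 1 - prob {x\<in>space M. X x \<le> q}"
    by (simp add: prob_compl)
  then have "prob {x\<in>space M. q < X x} = \<alpha>"
    using q(3) by (simp add: cdf)
  with q \<open>q \<noteq> b\<close> show "\<exists>q\<in>{a..<b}. prob {x\<in>space M. q < X x} = \<alpha>"
    by (intro bexI[of _ q]) auto
qed

text \<open>Fits the bias at level \<open>k / n\<close> into the first term of the stated bound:
  \<open>ln (3 / \<delta>)\<close> is at least 1 because \<open>exp 1 \<le> 3\<close> and \<delta>
  \<le> 1.\<close>

lemma sqrt_level_le: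
  assumes "0 < n" and "0 < \<delta>" "\<delta> \<le> 1"
  shows "sqrt (real k / real n / real n) \<le> sqrt (5 * real k * ln (3 / \<delta>) / (real n)\<^sup>2)"
proof -
  have "exp 1 \<le> (3::real)" by (rule exp_le)
  also have "(3::real) \<le> 3 / \<delta>" using assms by (simp add: field_simps)
  finally have "1 \<le> ln (3 / \<delta>)" using assms by (simp add: ln_ge_iff)
  then have "real k * 1 \<le> real k * (5 * ln (3 / \<delta>))"
    by (intro mult_left_mono) auto
  then have "real k \<le> 5 * real k * ln (3 / \<delta>)" by simp
  then have "real k / (real n)\<^sup>2 \<le> 5 * real k * ln (3 / \<delta>) / (real n)\<^sup>2"
    by (intro divide_right_mono) auto
  then show ?thesis by (simp add: power2_eq_square)
qed

text \<open>The support condition gives values in the interval only almost surely, so the deviation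
  bounds are applied to the clamped variable and sample. Clamping preserves independence and
  equality of laws, and changes CVaR not at all and empirical CVaR only on a null set.\<close>

theorem theorem5:
  fixes k m n :: nat
    and \<nu> \<mu> a b \<delta> :: real
    and M :: "'w measure" and P :: "'v measure"
    and s :: "'p \<Rightarrow> 'w \<Rightarrow> real"
    and S :: "'p \<Rightarrow> nat \<Rightarrow> 'v \<Rightarrow> real"
    and \<theta> :: 'p
  assumes "0 < m" and "m < k" and "k \<le> n"
    and "\<nu> = real k / real n" and "\<mu> = real m / real n"
    and "prob_space M" and "s \<theta> \<in> borel_measurable M"
    and "prob_space P"
    and "prob_space.indep_vars P (\<lambda>_. borel) (S \<theta>) {1..n}"
    and "\<And>i. i \<in> {1..n} \<Longrightarrow> distr P borel (S \<theta> i) = distr M borel (s \<theta>)"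
    and "law_support M (s \<theta>) \<subseteq> {a..b}"
    and "continuous_on UNIV (cdf (distr M borel (s \<theta>)))"
    and "0 < \<delta>" and "\<delta> \<le> 1"
  shows
    "let L = \<nu> * cvar M \<nu> (s \<theta>) - \<mu> * cvar M \<mu> (s \<theta>);
         Lhat = (\<lambda>\<omega>. \<nu> * empirical_cvar n \<nu> (\<lambda>i. S \<theta> i \<omega>)
                     - \<mu> * empirical_cvar n \<mu> (\<lambda>i. S \<theta> i \<omega>))
     in measure P {\<omega> \<in> space P. L - Lhat \<omega> \<le>
            (b - a) * (sqrt (5 * real k * ln (3 / \<delta>) / (real n)\<^sup>2)
                       + sqrt (ln (1 / \<delta>) / (2 * real n)))} \<ge> 1 - \<delta> \<and>
        measure P {\<omega> \<in> space P. L - Lhat \<omega> \<ge>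
            - (b - a) * (sqrt (5 * real m * ln (3 / \<delta>) / (real n)\<^sup>2)
                       + sqrt (ln (1 / \<delta>) / (2 * real n)))} \<ge> 1 - \<delta>"
proof -
  define t where "t = sqrt (ln (1 / \<delta>) / (2 * real n))"
  interpret P: prob_space P by fact
  interpret M: prob_space M by fact
  have n: "0 < n" using assms by simp
  have level: "0 < \<mu>" "\<mu> \<le> \<nu>" "\<nu> \<le> 1"
    using assms(1-3) by (auto simp: assms(4,5) divide_simps)
  note s[measurable] = \<open>s \<theta> \<in> borel_measurable M\<close>
  have S[measurable]: "i \<in> {1..n} \<Longrightarrow> S \<theta> i \<in> borel_measurable P" for i
    using assms(9) by (simp add: P.indep_vars_def)
  have D_ab: "AE x in distr M borel (s \<theta>). x \<in> {a..b}"
    using M.AE_in_law_support[OF s] by eventually_elim (use assms(11) in auto)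
  have s_ab: "AE x in M. s \<theta> x \<in> {a..b}"
    using D_ab by (subst (asm) AE_distr_iff) auto
  have S_ab: "AE \<omega> in P. S \<theta> i \<omega> \<in> {a..b}" if i: "i \<in> {1..n}" for i
    using D_ab unfolding assms(10)[OF i, symmetric] using i by (subst (asm) AE_distr_iff) auto
  note quantile = M.quantile_of_continuous_cdf[OF s s_ab assms(12)]
  have ab: "a < b" by (rule quantile)
  define X where "X x = clamp a b (s \<theta> x)" for x
  define Y where "Y i \<omega> = clamp a b (S \<theta> i \<omega>)" for i \<omega>
  have [measurable]: "X \<in> borel_measurable M"
    unfolding X_def[abs_def] by measurable
  interpret iid_sample P M n X Y a b
  proof unfold_locales
    show "P.indep_vars (\<lambda>_. borel) Y {1..n}"
      unfolding Y_def[abs_def] by (rule P.indep_vars_compose2[OF assms(9)]) measurable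
    show "distr P borel (Y i) = distr M borel X" if "i \<in> {1..n}" for i
    proof -
      have "distr P borel (Y i) = distr (distr P borel (S \<theta> i)) borel (clamp a b)"
        using that by (subst distr_distr) (auto simp: Y_def[abs_def] comp_def)
      also have "\<dots> = distr (distr M borel (s \<theta>)) borel (clamp a b)"
        using assms(10)[OF that] by simp
      also have "\<dots> = distr M borel X"
        by (subst distr_distr) (auto simp: X_def[abs_def] comp_def)
      finally show ?thesis .
    qed
  qed (use n ab clamp_in in \<open>auto simp: X_def Y_def less_imp_le\<close>)
  have cvar_X: "cvar M \<alpha> X = cvar M \<alpha> (s \<theta>)" for \<alpha>
    using s_ab by (intro cvar_cong_AE) (auto simp: X_def clamp_id)
  have quantile_X: "\<exists>q\<in>{a..b}. M.prob {x\<in>space M. q < X x} = \<gamma>" if \<gamma>: "0 < \<gamma>" "\<gamma> \<le> 1" for \<gamma>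
  proof -
    from quantile(2)[OF \<gamma>] obtain q where q: "q \<in> {a..<b}" "M.prob {x\<in>space M. q < s \<theta> x} = \<gamma>"
      by blast
    \<comment> \<open>Needs \<open>q < b\<close>: at \<open>q = b\<close> a value above
      \<open>b\<close> would be clamped down to \<open>q\<close>.\<close>
    from q(1) have "q < X x \<longleftrightarrow> q < s \<theta> x" for x
      by (auto simp: X_def clamp_def)
    with q show ?thesis by (intro bexI[of _ q]) auto
  qed
  define L where "L = \<nu> * cvar M \<nu> (s \<theta>) - \<mu> * cvar M \<mu> (s \<theta>)"
  define Lhat where "Lhat \<omega> = \<nu> * empirical_cvar n \<nu> (\<lambda>i. S \<theta> i \<omega>)
      - \<mu> * empirical_cvar n \<mu> (\<lambda>i. S \<theta> i \<omega>)" for \<omega>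
  have [measurable]: "Lhat \<in> borel_measurable P"
    unfolding Lhat_def[abs_def] using level
    by (intro borel_measurable_diff empirical_cvar_measurable n) auto
  have "AE \<omega> in P. \<forall>i\<in>{1..n}. S \<theta> i \<omega> \<in> {a..b}"
    using S_ab by (intro AE_finite_allI) auto
  then have Lhat: "AE \<omega> in P. Chat \<nu> \<omega> - Chat \<mu> \<omega> = Lhat \<omega>"
  proof eventually_elim
    case (elim \<omega>)
    then have "empirical_cvar n \<alpha> (\<lambda>i. Y i \<omega>) = empirical_cvar n \<alpha> (\<lambda>i. S \<theta> i \<omega>)" for \<alpha>
      by (intro empirical_cvar_cong) (simp add: Y_def clamp_id)
    then show ?case by (simp add: Chat_def Lhat_def)
  qed
  have dev: "1 - \<delta> \<le> P.prob {\<omega>\<in>space P. L - (Chat \<nu> \<omega> - Chat \<mu> \<omega>) \<le> (b - a) * (sqrt (\<nu> / n) + t)}"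
    "1 - \<delta> \<le> P.prob {\<omega>\<in>space P. L - (Chat \<nu> \<omega> - Chat \<mu> \<omega>) \<ge> - (b - a) * (sqrt (\<mu> / n) + t)}"
    using Chat_difference_deviation[OF level ab assms(13,14) quantile_X] by (simp_all add: L_def t_def cvar_X)
  have "1 - \<delta> \<le> P.prob {\<omega>\<in>space P. L - Lhat \<omega>
      \<le> (b - a) * (sqrt (5 * real k * ln (3 / \<delta>) / (real n)\<^sup>2) + t)}"
  \<comment> \<open>The event for the clamped sample is contained, up to a null set, in the target
    event, whose threshold is larger by \<open>sqrt_level_le\<close>.\<close>
  proof (rule order_trans[OF dev(1)], rule P.finite_measure_mono_AE)
    have le: "(b - a) * (sqrt (\<nu> / n) + t) \<le> (b - a) * (sqrt (5 * real k * ln (3 / \<delta>) / (real n)\<^sup>2) + t)"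
      using ab sqrt_level_le[OF n assms(13,14)] assms(4) by (intro mult_left_mono add_mono) auto
    from Lhat show "AE \<omega> in P. \<omega> \<in> {\<omega>\<in>space P. L - (Chat \<nu> \<omega> - Chat \<mu> \<omega>) \<le> (b - a) * (sqrt (\<nu> / n) + t)} \<longrightarrow>
        \<omega> \<in> {\<omega>\<in>space P. L - Lhat \<omega> \<le> (b - a) * (sqrt (5 * real k * ln (3 / \<delta>) / (real n)\<^sup>2) + t)}"
      by eventually_elim (use le in auto)
  qed measurable
  moreover have "1 - \<delta> \<le> P.prob {\<omega>\<in>space P. L - Lhat \<omega>
      \<ge> - (b - a) * (sqrt (5 * real m * ln (3 / \<delta>) / (real n)\<^sup>2) + t)}"
  proof (rule order_trans[OF dev(2)], rule P.finite_measure_mono_AE)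
    have le: "- (b - a) * (sqrt (5 * real m * ln (3 / \<delta>) / (real n)\<^sup>2) + t) \<le> - (b - a) * (sqrt (\<mu> / n) + t)"
      using ab sqrt_level_le[OF n assms(13,14)] assms(5) by (intro mult_left_mono_neg add_mono) auto
    from Lhat show "AE \<omega> in P. \<omega> \<in> {\<omega>\<in>space P. L - (Chat \<nu> \<omega> - Chat \<mu> \<omega>) \<ge> - (b - a) * (sqrt (\<mu> / n) + t)} \<longrightarrow>
        \<omega> \<in> {\<omega>\<in>space P. L - Lhat \<omega> \<ge> - (b - a) * (sqrt (5 * real m * ln (3 / \<delta>) / (real n)\<^sup>2) + t)}"
      by eventually_elim (use le in auto)
  qed measurable
  ultimately show ?thesis
    by (simp add: L_def Lhat_def t_def)
qed

end
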